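(* For any biconed graph $G^{A,B}$, the set $\mathcal{F}(G^{A,B}_{\mathrm{red}})$ of $2$-weighted forests of $G^{A,B}_{\mathrm{red}}$ is a pure multicomplex on the set of edges of $G^{A,B}_{\mathrm{red}}$, where a $2$-weighted forest $(F,\omega)$ is regarded as the multiset of edges in which each $e\in F$ occurs with multiplicity $\omega(e)$ (and edges not in $F$ do not occur).
   Context: Graphs are finite and undirected, possibly with loops and parallel edges. Biconed graph: let $G$ be a graph and $A,B\subseteq V(G)$ (not necessarily disjoint) with $A\cup B=V(G)$. The biconing $G^{A,B}$ of $G$ is obtained by adding two new vertices $0$ and $\overline{0}$ and the edges $0\overline{0}$, $0a$ for all $a\in A$, and $\overline{0}b$ for all $b\in B$. A biconed graph is any graph so obtained (with this data). Put $\overline{A}:=B\setminus A$, so $V(G)=A\sqcup\overline{A}$. Let $T_0$ be the spanning tree of $G^{A,B}$ with edges $0\overline{0}$, $0u$ ($u\in A$) and $\overline{0}v$ ($v\in\overline{A}$). Let $G^{A,B}_{\mathrm{red}}$ be the graph obtained from $G^{A,B}$ by deleting the edges of $T_0$ and the vertex $0$ (so its vertex set is $V(G)\cup\{\overline{0}\}$). Weighted forests: for a set $F\subseteq E(G^{A,B}_{\mathrm{red}})$ with a weighting $\omega:F\to\mathbb{N}_{\ge 1}$, regard $F$ as a spanning subgraph of $G^{A,B}_{\mathrm{red}}$ (all vertices included, isolated vertices being components). The excess weight of a connected component $S$ is $\delta_{\overline{0}\in S}+\sum_{e\in S}(\omega(e)-1)$, where $\delta_{\overline{0}\in S}$ is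 $1$ if $\overline{0}$ is a vertex of $S$ and $0$ otherwise. An edge $e\in F$ is called a weighted edge if $\omega(e)\ge 2$. An edge of $G^{A,B}_{\mathrm{red}}$ is crossing if it joins a vertex of $A$ to a vertex of $\overline{A}\cup\{\overline{0}\}$. A $2$-weighted forest of $G^{A,B}_{\mathrm{red}}$ is such a pair $(F,\omega)$ satisfying: (C0) $F$ is acyclic; (C1) at most one component has excess weight $2$; (C2) every other component has excess weight $0$ or $1$; (C3) in a component of excess weight $2$ not containing $\overline{0}$, the number of crossing edges in the unique shortest path containing all weighted edges of the component is odd; in a component of excess weight $2$ containing $\overline{0}$, the number of crossing edges in the shortest path containing both the weighted edge and $\overline{0}$ is odd. The empty set $F=\varnothing$ is allowed. A multicomplex on a finite set $E$ is a collection of finite multisets of elements of $E$ closed under taking sub-multisets. It is pure if all its facets (members maximal under inclusion) have the same cardinality, counted with multiplicity. *)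

theory Defs
  imports Main "HOL-Library.Multiset" "HOL-Library.Uprod" "HOL-Library.FuncSet"
begin

section \<open>Finite undirected multigraphs\<close>

text \<open>Edges are abstract labels with an unordered pair of end vertices, so that parallel edges
  are different labels with the same ends, and a loop at \<open>v\<close> has ends \<open>Upair v v\<close>.\<close>

record ('v, 'e) ugraph =
  verts :: "'v set"
  edges :: "'e set"
  ends :: "'e \<Rightarrow> 'v uprod"

definition finite_ugraph :: "('v, 'e) ugraph \<Rightarrow> bool" where
  "finite_ugraph H \<longleftrightarrow> finite (verts H) \<and> finite (edges H) \<and>
     (\<forall>e\<in>edges H. set_uprod (ends H e) \<subseteq> verts H)"

definition spanning_subgraph :: "('v, 'e) ugraph \<Rightarrow> 'e set \<Rightarrow> ('v, 'e) ugraph" where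
  "spanning_subgraph H F = H\<lparr>edges := F\<rparr>"

text \<open>A path is given by its pairwise distinct vertices and its edges in order; paths with a
  single vertex and no edges are allowed.\<close>

definition is_path :: "('v, 'e) ugraph \<Rightarrow> 'v list \<Rightarrow> 'e list \<Rightarrow> bool" where
  "is_path H vs es \<longleftrightarrow>
     length vs = Suc (length es) \<and> distinct vs \<and> set vs \<subseteq> verts H \<and> set es \<subseteq> edges H \<and>
     (\<forall>i<length es. ends H (es ! i) = Upair (vs ! i) (vs ! Suc i))"

text \<open>A cycle of length 1 is a loop and a cycle of length 2 is a pair of parallel edges.\<close>

definition is_cycle :: "('v, 'e) ugraph \<Rightarrow> 'v list \<Rightarrow> 'e list \<Rightarrow> bool" where
  "is_cycle H vs es \<longleftrightarrow>
     es \<noteq> [] \<and> length vs = length es \<and> distinct vs \<and> distinct es \<and>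
     set vs \<subseteq> verts H \<and> set es \<subseteq> edges H \<and>
     (\<forall>i<length es. ends H (es ! i) = Upair (vs ! i) (vs ! (Suc i mod length es)))"

definition acyclic_graph :: "('v, 'e) ugraph \<Rightarrow> bool" where
  "acyclic_graph H \<longleftrightarrow> \<not> (\<exists>vs es. is_cycle H vs es)"

definition connected_rel :: "('v, 'e) ugraph \<Rightarrow> ('v \<times> 'v) set" where
  "connected_rel H = {(u, v). \<exists>vs es. is_path H vs es \<and> hd vs = u \<and> last vs = v}"

text \<open>A component is represented by its vertex set.\<close>

definition components :: "('v, 'e) ugraph \<Rightarrow> 'v set set" where
  "components H = verts H // connected_rel H"

definition edges_in :: "('v, 'e) ugraph \<Rightarrow> 'v set \<Rightarrow> 'e set" where
  "edges_in H S = {e \<in> edges H. set_uprod (ends H e) \<subseteq> S}"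

definition shortest_path_containing ::
    "('v, 'e) ugraph \<Rightarrow> 'v set \<Rightarrow> 'e set \<Rightarrow> 'v list \<Rightarrow> 'e list \<Rightarrow> bool" where
  "shortest_path_containing H U W vs es \<longleftrightarrow>
     is_path H vs es \<and> U \<subseteq> set vs \<and> W \<subseteq> set es \<and>
     (\<forall>vs' es'. is_path H vs' es' \<and> U \<subseteq> set vs' \<and> W \<subseteq> set es' \<longrightarrow> length es \<le> length es')"


section \<open>Biconed graphs\<close>

text \<open>\<open>Zero\<close> is joined to \<open>A\<close> and \<open>Zero_bar\<close> to \<open>B\<close>; a vertex of \<open>A \<inter> B\<close> is joined to
  both.\<close>

datatype 'v bvert = Zero | Zero_bar | Orig 'v

datatype ('v, 'e) bedge = Orig_edge 'e | Base_edge | Zero_edge 'v | Zero_bar_edge 'v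

definition biconing_data :: "('v, 'e) ugraph \<Rightarrow> 'v set \<Rightarrow> 'v set \<Rightarrow> bool" where
  "biconing_data G A B \<longleftrightarrow> finite_ugraph G \<and> A \<subseteq> verts G \<and> B \<subseteq> verts G \<and> A \<union> B = verts G"

primrec biconing_ends :: "('v, 'e) ugraph \<Rightarrow> ('v, 'e) bedge \<Rightarrow> 'v bvert uprod" where
  "biconing_ends G (Orig_edge e) = map_uprod Orig (ends G e)"
| "biconing_ends G Base_edge = Upair Zero Zero_bar"
| "biconing_ends G (Zero_edge a) = Upair Zero (Orig a)"
| "biconing_ends G (Zero_bar_edge b) = Upair Zero_bar (Orig b)"

definition biconing ::
    "('v, 'e) ugraph \<Rightarrow> 'v set \<Rightarrow> 'v set \<Rightarrow> ('v bvert, ('v, 'e) bedge) ugraph" where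
  "biconing G A B =
     \<lparr> verts = {Zero, Zero_bar} \<union> Orig ` verts G,
       edges = Orig_edge ` edges G \<union> {Base_edge} \<union> Zero_edge ` A \<union> Zero_bar_edge ` B,
       ends = biconing_ends G \<rparr>"

definition base_tree :: "'v set \<Rightarrow> 'v set \<Rightarrow> ('v, 'e) bedge set" where
  "base_tree A B = {Base_edge} \<union> Zero_edge ` A \<union> Zero_bar_edge ` (B - A)"

text \<open>All edges at \<open>Zero\<close> belong to \<open>base_tree A B\<close>, so deleting the vertex \<open>Zero\<close> removes no
  further edges.\<close>

definition reduced ::
    "('v, 'e) ugraph \<Rightarrow> 'v set \<Rightarrow> 'v set \<Rightarrow> ('v bvert, ('v, 'e) bedge) ugraph" where
  "reduced G A B = (biconing G A B)
     \<lparr> verts := verts (biconing G A B) - {Zero},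
       edges := edges (biconing G A B) - base_tree A B \<rparr>"

definition crossing ::
    "('v, 'e) ugraph \<Rightarrow> 'v set \<Rightarrow> 'v set \<Rightarrow> ('v, 'e) bedge \<Rightarrow> bool" where
  "crossing G A B e \<longleftrightarrow>
     (\<exists>x \<in> Orig ` A. \<exists>y \<in> insert Zero_bar (Orig ` (B - A)). ends (reduced G A B) e = Upair x y)"


section \<open>Weighted forests\<close>

definition excess_weight ::
    "('v bvert, 'e) ugraph \<Rightarrow> ('e \<Rightarrow> nat) \<Rightarrow> 'v bvert set \<Rightarrow> nat" where
  "excess_weight H \<omega> S = of_bool (Zero_bar \<in> S) + (\<Sum>e\<in>edges_in H S. \<omega> e - 1)"

definition weighted_edges_in ::
    "('v, 'e) ugraph \<Rightarrow> ('e \<Rightarrow> nat) \<Rightarrow> 'v set \<Rightarrow> 'e set" where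
  "weighted_edges_in H \<omega> S = {e \<in> edges_in H S. 2 \<le> \<omega> e}"

text \<open>In the last conjunct, the path has to contain \<open>Zero_bar\<close> precisely if the component \<open>S\<close> does.
  As \<open>F\<close> is acyclic, the shortest path is unique up to reversal.\<close>

definition two_weighted_forest ::
    "('v, 'e) ugraph \<Rightarrow> 'v set \<Rightarrow> 'v set \<Rightarrow> ('v, 'e) bedge set \<Rightarrow> (('v, 'e) bedge \<Rightarrow> nat) \<Rightarrow> bool" where
  "two_weighted_forest G A B F \<omega> \<longleftrightarrow>
     (let H = spanning_subgraph (reduced G A B) F in
      F \<subseteq> edges (reduced G A B) \<and> \<omega> \<in> F \<rightarrow> {1..} \<and>
      acyclic_graph H \<and>
      card {S \<in> components H. excess_weight H \<omega> S = 2} \<le> 1 \<and>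
      (\<forall>S \<in> components H. excess_weight H \<omega> S \<noteq> 2 \<longrightarrow> excess_weight H \<omega> S \<in> {0, 1}) \<and>
      (\<forall>S \<in> components H. excess_weight H \<omega> S = 2 \<longrightarrow>
         (\<exists>vs es. shortest_path_containing H (S \<inter> {Zero_bar}) (weighted_edges_in H \<omega> S) vs es \<and>
            odd (card {e \<in> set es. crossing G A B e}))))"

text \<open>Only the values of \<open>\<omega>\<close> on \<open>F\<close> matter.\<close>

definition weighted_mset :: "'e set \<Rightarrow> ('e \<Rightarrow> nat) \<Rightarrow> 'e multiset" where
  "weighted_mset F \<omega> = (\<Sum>e\<in>F. replicate_mset (\<omega> e) e)"

definition two_weighted_forests ::
    "('v, 'e) ugraph \<Rightarrow> 'v set \<Rightarrow> 'v set \<Rightarrow> ('v, 'e) bedge multiset set" where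
  "two_weighted_forests G A B = {weighted_mset F \<omega> | F \<omega>. two_weighted_forest G A B F \<omega>}"


section \<open>Multicomplexes\<close>

definition multicomplex :: "'e set \<Rightarrow> 'e multiset set \<Rightarrow> bool" where
  "multicomplex E \<Delta> \<longleftrightarrow> finite E \<and> (\<forall>M\<in>\<Delta>. set_mset M \<subseteq> E) \<and>
     (\<forall>M\<in>\<Delta>. \<forall>N. N \<subseteq># M \<longrightarrow> N \<in> \<Delta>)"

definition facets :: "'e multiset set \<Rightarrow> 'e multiset set" where
  "facets \<Delta> = {M \<in> \<Delta>. \<forall>N\<in>\<Delta>. M \<subseteq># N \<longrightarrow> N = M}"

definition pure :: "'e multiset set \<Rightarrow> bool" where
  "pure \<Delta> \<longleftrightarrow> (\<forall>M\<in>facets \<Delta>. \<forall>N\<in>facets \<Delta>. size M = size N)"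

end

theory Submission
  imports Defs
begin

text \<open>Call the vertices in \<open>A\<close> one side and all others the other side. A path has an odd number of
  crossing edges iff its end vertices lie on different sides, and in a forest a path containing
  the prescribed edges and vertices is shortest once its two end vertices are forced. So (C3) says
  that a path spanned by the excess of the component joins the two sides.

  A forest with \<open>c\<close> components has \<open>|V| - c\<close> edges, so a 2-weighted forest has size
  \<open>|V| - 1\<close> plus the sum of \<open>excess - 1\<close> over its components. In a facet the components of excess 0
  are exactly the vertices other than \<open>Zero_bar\<close> without non-loop edges in the ambient graph: any
  other one could be joined to a neighbour or have one of its edges raised. A facet has a component
  of excess 2 iff the ambient graph has a crossing edge. If all excesses are at most 1 and the forest
  contains a crossing edge, its component meets both sides, and one raises the last edge of a path
  from \<open>Zero_bar\<close> or from the weighted edge to the other side; if the forest contains no crossing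
  edge, one can add any crossing edge, since every component lies on one side. Hence the size of a
  facet does not depend on the facet.\<close>

section \<open>Paths in multigraphs: joining, reversing, cutting and splitting at an edge\<close>

lemma is_path_spanning:
  "is_path (spanning_subgraph R F) vs es \<longleftrightarrow>
     length vs = Suc (length es) \<and> distinct vs \<and> set vs \<subseteq> verts R \<and> set es \<subseteq> F \<and>
     (\<forall>i<length es. ends R (es ! i) = Upair (vs ! i) (vs ! Suc i))"
  by (simp add: is_path_def spanning_subgraph_def)

lemma is_path_Nil: "is_path H [v] [] \<longleftrightarrow> v \<in> verts H"
  by (simp add: is_path_def)

lemma is_path_nonempty: "is_path H vs es \<Longrightarrow> vs \<noteq> []"
  by (auto simp: is_path_def)

lemma is_path_Cons:
  "is_path H (v # vs) (e # es) \<longleftrightarrow>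
     is_path H vs es \<and> v \<notin> set vs \<and> v \<in> verts H \<and> e \<in> edges H \<and> ends H e = Upair v (hd vs)"
  unfolding is_path_def
  by (cases vs) (auto simp: less_Suc_eq_0_disj nth_Cons split: nat.splits)

lemma is_path_append:
  assumes "is_path H vs es" "is_path H vs' es'" "set vs \<inter> set vs' = {}"
    and "e \<in> edges H" "ends H e = Upair (last vs) (hd vs')"
  shows "is_path H (vs @ vs') (es @ e # es')"
  using assms
proof (induction es arbitrary: vs)
  case Nil
  then obtain v where "vs = [v]" by (auto simp: is_path_def length_Suc_conv)
  with Nil show ?case by (simp add: is_path_Cons is_path_Nil)
next
  case (Cons a es)
  then obtain v ws where vs: "vs = v # ws" by (cases vs) (auto simp: is_path_def)
  with Cons.prems have p: "is_path H ws es" by (simp add: is_path_Cons)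
  then have "ws \<noteq> []" by (rule is_path_nonempty)
  with Cons vs p show ?case by (auto simp: is_path_Cons)
qed

lemma is_path_rev: "is_path H vs es \<Longrightarrow> is_path H (rev vs) (rev es)"
proof (induction es arbitrary: vs)
  case Nil
  then obtain v where "vs = [v]" by (auto simp: is_path_def length_Suc_conv)
  with Nil show ?case by simp
next
  case (Cons a es)
  then obtain v ws where vs: "vs = v # ws" by (cases vs) (auto simp: is_path_def)
  with Cons.prems have p: "is_path H ws es" and v: "v \<notin> set ws" "v \<in> verts H" "a \<in> edges H"
    "ends H a = Upair v (hd ws)" by (auto simp: is_path_Cons)
  have "is_path H (rev ws @ [v]) (rev es @ a # [])"
    using v is_path_nonempty[OF p]
    by (intro is_path_append Cons.IH[OF p])
      (auto simp: is_path_Nil last_rev Upair_inject)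
  with vs show ?case by simp
qed

lemma is_path_take:
  "is_path H vs es \<Longrightarrow> k \<le> length es \<Longrightarrow> is_path H (take (Suc k) vs) (take k es)"
  by (auto simp: is_path_def dest: in_set_takeD)

lemma is_path_drop:
  "is_path H vs es \<Longrightarrow> k \<le> length es \<Longrightarrow> is_path H (drop k vs) (drop k es)"
  by (auto simp: is_path_def dest: in_set_dropD)

lemma is_path_ends_subset:
  assumes "is_path H vs es" "e \<in> set es"
  shows "set_uprod (ends H e) \<subseteq> set vs"
proof -
  obtain i where "i < length es" "e = es ! i" using assms(2) by (auto simp: in_set_conv_nth)
  with assms(1) show ?thesis by (auto simp: is_path_def)
qed

text \<open>A second occurrence of the first edge would put the first vertex among the later
  vertices, by \<open>is_path_ends_subset\<close>.\<close>

lemma is_path_distinct_edges: "is_path H vs es \<Longrightarrow> distinct es"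
proof (induction es arbitrary: vs)
  case (Cons a es)
  then obtain v ws where vs: "vs = v # ws" by (cases vs) (auto simp: is_path_def)
  with Cons.prems have p: "is_path H ws es" and v: "v \<notin> set ws" "ends H a = Upair v (hd ws)"
    by (auto simp: is_path_Cons)
  with is_path_ends_subset[OF p, of a] have "a \<notin> set es" by auto
  with Cons.IH[OF p] show ?case by simp
qed simp

lemma is_path_edge_split:
  assumes "is_path H vs es" "e \<in> set es"
  obtains vs1 vs2 es1 es2 where "vs = vs1 @ vs2" "es = es1 @ e # es2"
    "is_path H vs1 es1" "is_path H vs2 es2" "ends H e = Upair (last vs1) (hd vs2)"
proof -
  obtain i where i: "i < length es" "e = es ! i" using assms(2) by (auto simp: in_set_conv_nth)
  have l: "length vs = Suc (length es)" using assms(1) by (simp add: is_path_def)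
  show thesis
  proof
    show "vs = take (Suc i) vs @ drop (Suc i) vs" by simp
    show "es = take i es @ e # drop (Suc i) es" using i by (simp add: id_take_nth_drop)
    show "is_path H (take (Suc i) vs) (take i es)" using assms(1) i by (simp add: is_path_take)
    show "is_path H (drop (Suc i) vs) (drop (Suc i) es)" using assms(1) i by (simp add: is_path_drop)
    show "ends H e = Upair (last (take (Suc i) vs)) (hd (drop (Suc i) vs))"
      using assms(1) i l by (simp add: is_path_def hd_drop_conv_nth take_Suc_conv_app_nth)
  qed
qed

section \<open>Connectivity and forests\<close>

locale multigraph =
  fixes R :: "('v, 'e) ugraph"
  assumes finite_R: "finite_ugraph R"
begin

abbreviation V where "V \<equiv> verts R"
abbreviation E where "E \<equiv> edges R"
abbreviation sub where "sub F \<equiv> spanning_subgraph R F"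

definition adj :: "'e set \<Rightarrow> ('v \<times> 'v) set" where
  "adj F = {(u, v). \<exists>e\<in>F. ends R e = Upair u v}"

text \<open>Unlike \<open>connected_rel\<close>, this closure does not refer to the vertex set, so
  it is reflexive everywhere and the effect of one more edge can be computed by induction.\<close>

definition conn :: "'e set \<Rightarrow> ('v \<times> 'v) set" where
  "conn F = (adj F)\<^sup>*"

definition cmp :: "'e set \<Rightarrow> 'v \<Rightarrow> 'v set" where
  "cmp F v = conn F `` {v}"

text \<open>Acyclicity in the form that every edge is a bridge. Loops are excluded because
  \<open>conn\<close> is reflexive.\<close>

definition forest :: "'e set \<Rightarrow> bool" where
  "forest F \<longleftrightarrow> (\<forall>e\<in>F. \<forall>u v. ends R e = Upair u v \<longrightarrow> (u, v) \<notin> conn (F - {e}))"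

lemma finite_V: "finite V" and finite_E: "finite E"
  using finite_R by (auto simp: finite_ugraph_def)

lemma edge_verts: "e \<in> E \<Longrightarrow> set_uprod (ends R e) \<subseteq> V"
  using finite_R by (auto simp: finite_ugraph_def)

lemma edge_vertsD: "e \<in> E \<Longrightarrow> ends R e = Upair u v \<Longrightarrow> u \<in> V \<and> v \<in> V"
  using edge_verts[of e] by auto

lemma sub_sel [simp]: "verts (sub F) = V" "edges (sub F) = F" "ends (sub F) = ends R"
  by (simp_all add: spanning_subgraph_def)

lemma conn_refl [simp]: "(u, u) \<in> conn F"
  by (simp add: conn_def)

lemma sym_adj: "sym (adj F)"
  unfolding adj_def sym_def by (auto, metis Upair_inject)

lemma conn_sym: "(u, v) \<in> conn F \<Longrightarrow> (v, u) \<in> conn F"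
  unfolding conn_def using sym_rtrancl[OF sym_adj] by (auto dest: symD)

lemma conn_trans: "(u, v) \<in> conn F \<Longrightarrow> (v, w) \<in> conn F \<Longrightarrow> (u, w) \<in> conn F"
  unfolding conn_def by (rule rtrancl_trans)

lemma conn_edge: "e \<in> F \<Longrightarrow> ends R e = Upair u v \<Longrightarrow> (u, v) \<in> conn F"
  unfolding conn_def adj_def by (rule r_into_rtrancl) auto

lemma conn_mono: "F \<subseteq> F' \<Longrightarrow> conn F \<subseteq> conn F'"
  unfolding conn_def by (rule rtrancl_mono) (auto simp: adj_def)

lemma conn_empty: "conn {} = Id"
  by (simp add: conn_def adj_def)

text \<open>A connection that runs through \<open>f\<close> several times can be shortened to one
  that uses \<open>f\<close> at most once, in one of its two directions.\<close>

lemma conn_insert: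
  assumes "ends R f = Upair a b"
  shows "(x, y) \<in> conn (insert f F) \<longleftrightarrow> (x, y) \<in> conn F \<or>
    (x, a) \<in> conn F \<and> (b, y) \<in> conn F \<or> (x, b) \<in> conn F \<and> (a, y) \<in> conn F" (is "?L \<longleftrightarrow> ?R")
proof
  assume ?L
  then show ?R unfolding conn_def[of "insert f F"]
  proof (induction rule: rtrancl_induct)
    case base
    then show ?case by simp
  next
    case (step y z)
    from step.hyps(2) consider "(y, z) \<in> conn F" | "y = a" "z = b" | "y = b" "z = a"
      using assms conn_edge by (auto simp: adj_def Upair_inject)
    then show ?case using step.IH by cases (auto intro: conn_trans)
  qed
next
  have m: "(u, v) \<in> conn F \<Longrightarrow> (u, v) \<in> conn (insert f F)" for u v
    using conn_mono[of F "insert f F"] by auto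
  have ab: "(a, b) \<in> conn (insert f F)" using assms by (auto intro: conn_edge)
  assume ?R
  then show ?L
    using m[of x y] m[of x a] m[of b y] m[of x b] m[of a y] ab conn_sym[OF ab]
      conn_trans[of x a "insert f F" b] conn_trans[of x b "insert f F" y]
      conn_trans[of x b "insert f F" a] conn_trans[of x a "insert f F" y] by blast
qed

lemma path_conn_hd:
  "is_path (sub F) vs es \<Longrightarrow> x \<in> set vs \<Longrightarrow> (hd vs, x) \<in> conn F"
proof (induction es arbitrary: vs x)
  case Nil
  then obtain v where "vs = [v]" by (auto simp: is_path_def length_Suc_conv)
  with Nil show ?case by simp
next
  case (Cons a es)
  then obtain v ws where vs: "vs = v # ws" by (cases vs) (auto simp: is_path_def)
  with Cons.prems have p: "is_path (sub F) ws es" and "(v, hd ws) \<in> conn F"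
    by (auto simp: is_path_Cons intro: conn_edge)
  with vs Cons show ?case by (auto intro: conn_trans)
qed

lemma path_conn:
  "is_path (sub F) vs es \<Longrightarrow> x \<in> set vs \<Longrightarrow> y \<in> set vs \<Longrightarrow> (x, y) \<in> conn F"
  by (meson conn_sym conn_trans path_conn_hd)

lemma path_mono: "is_path (sub F) vs es \<Longrightarrow> set es \<subseteq> F' \<Longrightarrow> is_path (sub F') vs es"
  by (auto simp: is_path_spanning)

text \<open>The path is built edge by edge; a step back to a visited vertex is replaced by cutting
  the path at that vertex, which keeps the vertices distinct.\<close>

lemma conn_path:
  assumes "F \<subseteq> E" "u \<in> V" "(u, v) \<in> conn F"
  obtains vs es where "is_path (sub F) vs es" "hd vs = u" "last vs = v"
proof -
  have "\<exists>vs es. is_path (sub F) vs es \<and> hd vs = u \<and> last vs = v"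
    using assms(3) unfolding conn_def
  proof (induction rule: rtrancl_induct)
    case base
    have "is_path (sub F) [u] []" using assms(2) by (simp add: is_path_Nil)
    then show ?case by force
  next
    case (step y z)
    from step.IH obtain vs es where p: "is_path (sub F) vs es" "hd vs = u" "last vs = y" by blast
    from step.hyps(2) obtain e where e: "e \<in> F" "ends R e = Upair y z" by (auto simp: adj_def)
    have l: "length vs = Suc (length es)" using p(1) by (simp add: is_path_def)
    show ?case
    proof (cases "z \<in> set vs")
      case True
      then obtain k where k: "k < length vs" "vs ! k = z" by (auto simp: in_set_conv_nth)
      have "is_path (sub F) (take (Suc k) vs) (take k es)" using p k l by (auto intro: is_path_take)
      moreover have "hd (take (Suc k) vs) = u" using p by simp
      moreover have "last (take (Suc k) vs) = z" using k l by (simp add: take_Suc_conv_app_nth)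
      ultimately show ?thesis by blast
    next
      case False
      have "is_path (sub F) (vs @ [z]) (es @ e # [])"
        using p False e assms(1) edge_vertsD[of e y z]
        by (intro is_path_append) (auto simp: is_path_Nil)
      moreover have "hd (vs @ [z]) = u" using p is_path_nonempty[OF p(1)] by simp
      ultimately show ?thesis by fastforce
    qed
  qed
  with that show thesis by blast
qed

text \<open>Replaces the quotient by path connectivity, as in the definitions, by the classes
  \<open>cmp\<close>, which behave well under adding edges.\<close>

lemma components_sub:
  assumes "F \<subseteq> E"
  shows "components (sub F) = cmp F ` V"
proof -
  have "connected_rel (sub F) `` {v} = cmp F v" if "v \<in> V" for v
  proof -
    have "(v, w) \<in> connected_rel (sub F) \<longleftrightarrow> (v, w) \<in> conn F" for w
    proof
      assume "(v, w) \<in> connected_rel (sub F)"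
      then obtain vs es where p: "is_path (sub F) vs es" "hd vs = v" "last vs = w"
        unfolding connected_rel_def by blast
      then have "vs \<noteq> []" by (auto dest: is_path_nonempty)
      with p show "(v, w) \<in> conn F" using path_conn_hd[of F vs es w] by auto
    next
      assume c: "(v, w) \<in> conn F"
      obtain vs es where "is_path (sub F) vs es" "hd vs = v" "last vs = w"
        by (rule conn_path[OF assms \<open>v \<in> V\<close> c])
      then show "(v, w) \<in> connected_rel (sub F)" unfolding connected_rel_def by blast
    qed
    then show ?thesis by (auto simp: cmp_def)
  qed
  then show ?thesis by (simp add: components_def quotient_def UNION_singleton_eq_range)
qed

section \<open>Forests and their components\<close>

text \<open>Without its closing edge \<open>e\<close>, a cycle is a path joining the ends of
  \<open>e\<close>, so \<open>e\<close> is not a bridge.\<close>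

lemma forest_imp_acyclic:
  assumes "forest F"
  shows "acyclic_graph (sub F)"
  unfolding acyclic_graph_def
proof
  assume "\<exists>vs es. is_cycle (sub F) vs es"
  then obtain vs es where "is_cycle (sub F) vs es" by blast
  then have c: "es \<noteq> []" "length vs = length es" "distinct vs" "distinct es" "set vs \<subseteq> V"
      "set es \<subseteq> F"
    and s: "\<And>i. i < length es \<Longrightarrow> ends R (es ! i) = Upair (vs ! i) (vs ! (Suc i mod length es))"
    by (auto simp: is_cycle_def)
  define n where "n = length es - 1"
  have n: "length es = Suc n" using c(1) by (simp add: n_def)
  define e where "e = es ! n"
  have "is_path (sub (F - {e})) vs (butlast es)"
    unfolding is_path_spanning
  proof (intro conjI allI impI)
    show "set (butlast es) \<subseteq> F - {e}"
      using c(1,4,6) n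
      by (auto simp: e_def in_set_conv_nth nth_butlast nth_eq_iff_index_eq dest: in_set_butlastD)
  qed (use c n s in \<open>auto simp: nth_butlast\<close>)
  then have "(vs ! n, vs ! 0) \<in> conn (F - {e})" using c n by (auto intro!: path_conn)
  moreover have "ends R e = Upair (vs ! n) (vs ! 0)" using s[of n] n by (simp add: e_def)
  moreover have "e \<in> F" using c n by (auto simp: e_def)
  ultimately show False using assms by (auto simp: forest_def)
qed

text \<open>A path joining the ends of \<open>e\<close> without using \<open>e\<close> is closed by
  \<open>e\<close> to a cycle. For a loop this path has no edges and the cycle has length 1.\<close>

lemma acyclic_imp_forest:
  assumes "acyclic_graph (sub F)" "F \<subseteq> E"
  shows "forest F"
  unfolding forest_def
proof (intro ballI allI impI notI)
  fix e u v assume e: "e \<in> F" "ends R e = Upair u v" "(u, v) \<in> conn (F - {e})"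
  have "u \<in> V" using e assms edge_vertsD by blast
  then obtain vs es where p: "is_path (sub (F - {e})) vs es" and uv: "hd vs = u" "last vs = v"
    using conn_path[of "F - {e}" u v] e assms by blast
  have d: "distinct es" using p by (rule is_path_distinct_edges)
  have l: "length vs = Suc (length es)" and dv: "distinct vs" "set vs \<subseteq> V" "set es \<subseteq> F - {e}"
    and s: "\<And>i. i < length es \<Longrightarrow> ends R (es ! i) = Upair (vs ! i) (vs ! Suc i)"
    using p by (auto simp: is_path_spanning)
  have "vs \<noteq> []" using p by (rule is_path_nonempty)
  then have "vs ! length es = v" "vs ! 0 = u"
    using uv l by (simp_all add: last_conv_nth hd_conv_nth)
  then have ee: "ends R e = Upair (vs ! length es) (vs ! 0)"
    using e(2) by (simp add: Upair_inject)
  have "is_cycle (sub F) vs (es @ [e])"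
    unfolding is_cycle_def
  proof (intro conjI allI impI)
    fix i assume "i < length (es @ [e])"
    then consider "i < length es" | "i = length es" by fastforce
    then show "ends (sub F) ((es @ [e]) ! i) = Upair (vs ! i) (vs ! (Suc i mod length (es @ [e])))"
      by cases (simp_all add: nth_append s ee)
  qed (use d dv e(1) l in auto)
  with assms show False by (auto simp: acyclic_graph_def)
qed

lemma forest_iff_acyclic: "F \<subseteq> E \<Longrightarrow> acyclic_graph (sub F) \<longleftrightarrow> forest F"
  using forest_imp_acyclic acyclic_imp_forest by blast

lemma forest_mono: "forest F \<Longrightarrow> F' \<subseteq> F \<Longrightarrow> forest F'"
  unfolding forest_def by (meson Diff_mono conn_mono order_refl subsetD)

text \<open>If an old edge \<open>e\<close> stopped being a bridge, the new connection of its ends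
  would run through \<open>f\<close>. Each end of \<open>f\<close> would then be connected in
  \<open>F\<close> to an end of \<open>e\<close>, and \<open>e\<close> itself would connect
  \<open>a\<close> with \<open>b\<close>.\<close>

lemma forest_insert:
  assumes F: "forest F" and f: "ends R f = Upair a b" and ab: "(a, b) \<notin> conn F"
  shows "forest (insert f F)"
  unfolding forest_def
proof (intro ballI allI impI notI)
  fix e x y assume e: "e \<in> insert f F" "ends R e = Upair x y" and c: "(x, y) \<in> conn (insert f F - {e})"
  show False
  proof (cases "e = f")
    case True
    then have "(x, y) \<in> conn F" using c conn_mono[of "insert f F - {e}" F] by auto
    then show False using True e(2) f ab conn_sym[of x y F] by (auto simp: Upair_inject)
  next
    case False
    then have eF: "e \<in> F" using e by simp
    have "insert f F - {e} = insert f (F - {e})" using False by auto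
    moreover have "(x, y) \<notin> conn (F - {e})" using F eF e(2) by (auto simp: forest_def)
    ultimately have "(x, a) \<in> conn F \<and> (b, y) \<in> conn F \<or> (x, b) \<in> conn F \<and> (a, y) \<in> conn F"
      using c conn_mono[of "F - {e}" F] by (auto simp: conn_insert[OF f])
    moreover have "(x, y) \<in> conn F" using eF e(2) by (rule conn_edge)
    ultimately show False
      using ab conn_sym[of x a F] conn_sym[of b y F] conn_sym[of x b F] conn_sym[of x y F]
        conn_trans[of a x F y] conn_trans[of a y F b] conn_trans[of a y F x] conn_trans[of a x F b]
      by blast
  qed
qed

lemma forest_edge_ends:
  "forest F \<Longrightarrow> e \<in> F \<Longrightarrow> ends R e = Upair u v \<Longrightarrow> u \<noteq> v"
  unfolding forest_def using conn_refl by blast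

lemma cmp_refl [simp]: "v \<in> cmp F v"
  by (simp add: cmp_def)

lemma cmp_eq: "w \<in> cmp F v \<Longrightarrow> cmp F w = cmp F v"
  using conn_sym[of v w F] conn_trans[of v w F] conn_trans[of w v F] by (auto simp: cmp_def)

lemma cmp_eq_iff: "cmp F u = cmp F v \<longleftrightarrow> (u, v) \<in> conn F"
proof
  assume "cmp F u = cmp F v"
  then have "v \<in> cmp F u" by simp
  then show "(u, v) \<in> conn F" by (simp add: cmp_def)
next
  assume "(u, v) \<in> conn F"
  then have "v \<in> cmp F u" by (simp add: cmp_def)
  then show "cmp F u = cmp F v" by (simp add: cmp_eq)
qed

lemma cmp_eqI: "S \<in> cmp F ` V \<Longrightarrow> x \<in> S \<Longrightarrow> S = cmp F x"
  by (auto simp: cmp_eq)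

lemma cmp_mono: "F \<subseteq> F' \<Longrightarrow> cmp F v \<subseteq> cmp F' v"
  using conn_mono[of F F'] by (auto simp: cmp_def)

lemma cmp_insert:
  assumes "ends R f = Upair a b"
  shows "cmp (insert f F) x =
    (if x \<in> cmp F a \<union> cmp F b then cmp F a \<union> cmp F b else cmp F x)"
proof -
  have "y \<in> cmp (insert f F) x \<longleftrightarrow>
      y \<in> (if x \<in> cmp F a \<union> cmp F b then cmp F a \<union> cmp F b else cmp F x)" for y
    using conn_sym[of x a F] conn_sym[of a x F] conn_sym[of x b F] conn_sym[of b x F]
      conn_trans[of a x F y] conn_trans[of b x F y] conn_trans[of x a F y] conn_trans[of x b F y]
    by (auto simp: cmp_def conn_insert[OF assms])
  then show ?thesis by blast
qed

lemma components_insert: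
  assumes "ends R f = Upair a b" "f \<in> E"
  shows "cmp (insert f F) ` V =
    insert (cmp F a \<union> cmp F b) (cmp F ` V - {cmp F a, cmp F b})" (is "?L = ?Q")
proof
  have ab: "a \<in> V" "b \<in> V" using assms edge_vertsD by auto
  have "cmp F x \<noteq> cmp F y" if "x \<notin> cmp F y" for x y
    using that cmp_refl by metis
  then show "?L \<subseteq> ?Q"
    by (auto simp: cmp_insert[OF assms(1)])
  show "?Q \<subseteq> ?L"
  proof
    fix S assume "S \<in> ?Q"
    then consider "S = cmp F a \<union> cmp F b" | x where "x \<in> V" "S = cmp F x" "S \<noteq> cmp F a" "S \<noteq> cmp F b"
      by auto
    then show "S \<in> ?L"
    proof cases
      case 1
      then have "S = cmp (insert f F) a" by (simp add: cmp_insert[OF assms(1)])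
      with ab show ?thesis by blast
    next
      case 2
      then have "S = cmp (insert f F) x" using cmp_eq[of x F] by (auto simp: cmp_insert[OF assms(1)])
      with 2 show ?thesis by blast
    qed
  qed
qed

text \<open>Induction on the edges: an edge of a forest joins two different components of the rest,
  so it lowers the number of components by one.\<close>

lemma card_forest:
  assumes "forest F" "F \<subseteq> E"
  shows "card F + card (cmp F ` V) = card V"
proof -
  have "finite F" using assms(2) finite_E finite_subset by blast
  then show ?thesis using assms
  proof (induction F)
    case empty
    have "cmp {} = (\<lambda>v. {v})" by (auto simp: cmp_def conn_empty)
    then show ?case by (simp add: card_image)
  next
    case (insert f F)
    obtain a b where f: "ends R f = Upair a b" by (cases "ends R f") auto
    have fE: "f \<in> E" and FE: "F \<subseteq> E" using insert by auto
    have ab: "a \<in> V" "b \<in> V" using f fE edge_vertsD by auto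
    have "(a, b) \<notin> conn F" using insert.prems insert.hyps f unfolding forest_def by (metis Diff_insert_absorb insertI1)
    then have ne: "cmp F a \<noteq> cmp F b" by (simp add: cmp_eq_iff)
    \<comment> \<open>A component equal to this union would have to equal both
      \<open>cmp F a\<close> and \<open>cmp F b\<close>.\<close>
    have "cmp F a \<union> cmp F b \<notin> cmp F ` V"
      using ne cmp_eqI[of "cmp F a \<union> cmp F b" F a] cmp_eqI[of "cmp F a \<union> cmp F b" F b] by auto
    then have "card (cmp (insert f F) ` V) = Suc (card (cmp F ` V - {cmp F a, cmp F b}))"
      using finite_V by (simp add: components_insert[OF f fE])
    also have "card (cmp F ` V - {cmp F a, cmp F b}) = card (cmp F ` V) - 2"
      using ab ne by (simp add: card_Diff_subset)
    \<comment> \<open>This bound is what makes the truncated subtraction of 2 above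
      harmless.\<close>
    also have "card (cmp F ` V) \<ge> card {cmp F a, cmp F b}"
      using ab finite_V by (intro card_mono) auto
    then have "card (cmp F ` V) \<ge> 2" using ne by simp
    moreover have "card F + card (cmp F ` V) = card V"
      using insert.IH forest_mono[OF insert.prems(1)] FE by blast
    ultimately show ?case using insert.hyps by simp
  qed
qed

text \<open>Deleting an edge of the first path disconnects its two end vertices.\<close>

lemma forest_path_subset:
  assumes F: "forest F" and p: "is_path (sub F) vs es" and q: "is_path (sub F) ws fs"
    and "hd vs \<in> set ws" "last vs \<in> set ws"
  shows "set es \<subseteq> set fs"
proof
  fix g assume g: "g \<in> set es"
  show "g \<in> set fs"
  proof (rule ccontr)
    assume ng: "g \<notin> set fs"
    have gF: "g \<in> F" using p g by (auto simp: is_path_spanning)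
    from p g obtain vs1 vs2 es1 es2 where sp: "vs = vs1 @ vs2" "es = es1 @ g # es2"
      "is_path (sub F) vs1 es1" "is_path (sub F) vs2 es2" "ends R g = Upair (last vs1) (hd vs2)"
      by (rule is_path_edge_split) auto
    have "g \<notin> set es1" "g \<notin> set es2" using is_path_distinct_edges[OF p] sp by auto
    then have "is_path (sub (F - {g})) vs1 es1" "is_path (sub (F - {g})) vs2 es2"
      "is_path (sub (F - {g})) ws fs"
      using sp(3,4) q ng by (auto simp: is_path_spanning)
    \<comment> \<open>A detour avoiding \<open>g\<close>: back along the first part to
      \<open>hd vs\<close>, along the second path to \<open>last vs\<close>, and back to
      \<open>hd vs2\<close>.\<close>
    then have "(last vs1, hd vs) \<in> conn (F - {g})" "(last vs, hd vs2) \<in> conn (F - {g})"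
      "(hd vs, last vs) \<in> conn (F - {g})"
      using is_path_nonempty[OF sp(3)] is_path_nonempty[OF sp(4)] assms(4,5)
      by (auto simp: sp(1) intro: path_conn)
    then have "(last vs1, hd vs2) \<in> conn (F - {g})" by (meson conn_trans)
    with F gF sp(5) show False by (auto simp: forest_def)
  qed
qed

text \<open>Take a path from \<open>x\<close> to \<open>y\<close>. If it avoids \<open>x'\<close>,
  put \<open>e\<close> in front of it; if it visits \<open>x'\<close>, replace its part up to
  \<open>x'\<close> by \<open>e\<close>.\<close>

lemma path_from_edge:
  assumes "F \<subseteq> E" "e \<in> F" "ends R e = Upair x x'" "x \<noteq> x'" "(x, y) \<in> conn F"
  obtains vs es where "is_path (sub F) vs es" "es \<noteq> []" "hd es = e" "hd vs \<in> {x, x'}" "last vs = y"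
proof -
  have xV: "x \<in> V" "x' \<in> V" using assms edge_vertsD by blast+
  from conn_path[OF assms(1) xV(1) assms(5)] obtain vs es where
    p: "is_path (sub F) vs es" "hd vs = x" "last vs = y" by blast
  have ne: "vs \<noteq> []" using p(1) by (rule is_path_nonempty)
  show thesis
  proof (cases "x' \<in> set vs")
    case False
    have "is_path (sub F) (x' # vs) (e # es)"
      using p False assms xV by (auto simp: is_path_Cons Upair_inject)
    with p ne show thesis by (intro that[of "x' # vs" "e # es"]) auto
  next
    case True
    then obtain k where k: "k < length vs" "vs ! k = x'" by (auto simp: in_set_conv_nth)
    have l: "length vs = Suc (length es)" "distinct vs" using p(1) by (auto simp: is_path_def)
    have "k \<noteq> 0" using k p ne assms(4) by (metis hd_conv_nth)
    have hd: "hd (drop k vs) = x'" using k by (simp add: hd_drop_conv_nth)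
    have "x \<notin> set (drop k vs)"
    proof
      assume "x \<in> set (drop k vs)"
      moreover have "x \<in> set (take k vs)"
        using \<open>k \<noteq> 0\<close> p ne by (cases vs; cases k) auto
      moreover have "distinct (take k vs @ drop k vs)" using l by simp
      ultimately show False by (auto simp del: append_take_drop_id)
    qed
    moreover have "is_path (sub F) (drop k vs) (drop k es)" using p k l by (auto intro: is_path_drop)
    ultimately have "is_path (sub F) (x # drop k vs) (e # drop k es)"
      using hd assms xV by (auto simp: is_path_Cons)
    with p k show thesis by (intro that[of "x # drop k vs" "e # drop k es"]) auto
  qed
qed

end

section \<open>End vertices of shortest paths\<close>

lemma is_path_hd_edge:
  "is_path H vs es \<Longrightarrow> es \<noteq> [] \<Longrightarrow> hd vs \<in> set_uprod (ends H (hd es))"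
  by (cases vs; cases es) (auto simp: is_path_Cons is_path_def)

lemma is_path_last_edge:
  assumes "is_path H vs es" "es \<noteq> []"
  shows "last vs \<in> set_uprod (ends H (last es))"
  using is_path_hd_edge[OF is_path_rev[OF assms(1)]] assms is_path_nonempty[OF assms(1)]
  by (simp add: hd_rev)

lemma shortest_path_containing_rev:
  "shortest_path_containing H U W vs es \<Longrightarrow> shortest_path_containing H U W (rev vs) (rev es)"
  by (auto simp: shortest_path_containing_def is_path_rev)

text \<open>Otherwise the first vertex and the first edge could be dropped, leaving a shorter path
  that still contains \<open>U\<close> and \<open>W\<close>.\<close>

lemma shortest_path_containing_hd:
  assumes s: "shortest_path_containing H U W vs es" and "es \<noteq> []"
  shows "hd vs \<in> U \<union> (\<Union>e\<in>W. set_uprod (ends H e))"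
proof (rule ccontr)
  assume n: "hd vs \<notin> U \<union> (\<Union>e\<in>W. set_uprod (ends H e))"
  have p: "is_path H vs es" "U \<subseteq> set vs" "W \<subseteq> set es"
    using s by (auto simp: shortest_path_containing_def)
  obtain v ws where vs: "vs = v # ws" using is_path_nonempty[OF p(1)] by (cases vs) auto
  obtain e fs where es: "es = e # fs" using assms(2) by (cases es) auto
  have q: "is_path H ws fs" using p(1) vs es by (simp add: is_path_Cons)
  have "e \<notin> W" using is_path_hd_edge[OF p(1) assms(2)] n es by auto
  then have "U \<subseteq> set ws" "W \<subseteq> set fs" using p n vs es by auto
  with q s have "length es \<le> length fs" unfolding shortest_path_containing_def by blast
  with es show False by simp
qed

lemma shortest_path_containing_last:
  assumes s: "shortest_path_containing H U W vs es" and "es \<noteq> []"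
  shows "last vs \<in> U \<union> (\<Union>e\<in>W. set_uprod (ends H e))"
proof -
  have "vs \<noteq> []" using s by (auto simp: shortest_path_containing_def dest: is_path_nonempty)
  with shortest_path_containing_hd[OF shortest_path_containing_rev[OF s]] assms(2)
  show ?thesis by (simp add: hd_rev)
qed

section \<open>Weighted forests as multisets\<close>

text \<open>Abstracts from the biconing: \<open>A\<close> stands for the image of the original
  \<open>A\<close> under \<open>Orig\<close>, and the other side, including \<open>Zero_bar\<close>,
  is its complement.\<close>

locale sided_graph = multigraph R for R :: "('v bvert, 'e) ugraph" +
  fixes A :: "'v bvert set"
  assumes root: "Zero_bar \<in> verts R"
begin

definition cross :: "'e \<Rightarrow> bool" where
  "cross e \<longleftrightarrow> (\<exists>x y. ends R e = Upair x y \<and> x \<in> A \<and> y \<notin> A)"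

abbreviation ends_of :: "'e set \<Rightarrow> 'v bvert set" where
  "ends_of W \<equiv> \<Union>e\<in>W. set_uprod (ends R e)"

text \<open>(C3) without minimality and without counting: the path must begin and end at prescribed
  vertices or at ends of prescribed edges, and these two vertices lie on different sides.\<close>

definition odd_span :: "'e set \<Rightarrow> 'v bvert set \<Rightarrow> 'e set \<Rightarrow> bool" where
  "odd_span F U W \<longleftrightarrow> (\<exists>vs es. is_path (sub F) vs es \<and> U \<subseteq> set vs \<and> W \<subseteq> set es \<and>
     hd vs \<in> U \<union> ends_of W \<and> last vs \<in> U \<union> ends_of W \<and> (hd vs \<in> A) \<noteq> (last vs \<in> A))"

definition edges_within :: "'v bvert set \<Rightarrow> 'e set" where
  "edges_within S = {e \<in> E. set_uprod (ends R e) \<subseteq> S}"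

text \<open>The sum runs over all edges of \<open>R\<close> within \<open>S\<close>, so its index
  set does not depend on \<open>M\<close>; an edge absent from \<open>M\<close> contributes the
  truncated difference \<open>0 - 1 = 0\<close>.\<close>

definition exc :: "'e multiset \<Rightarrow> 'v bvert set \<Rightarrow> nat" where
  "exc M S = of_bool (Zero_bar \<in> S) + (\<Sum>e\<in>edges_within S. count M e - 1)"

definition wedges :: "'e multiset \<Rightarrow> 'v bvert set \<Rightarrow> 'e set" where
  "wedges M S = {e \<in> edges_within S. 2 \<le> count M e}"

abbreviation comps :: "'e multiset \<Rightarrow> 'v bvert set set" where
  "comps M \<equiv> cmp (set_mset M) ` V"

definition good :: "'e multiset \<Rightarrow> bool" where
  "good M \<longleftrightarrow> set_mset M \<subseteq> E \<and> forest (set_mset M) \<and>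
     (\<forall>S\<in>comps M. exc M S \<le> 2) \<and>
     (\<forall>S\<in>comps M. \<forall>T\<in>comps M. exc M S = 2 \<longrightarrow> exc M T = 2 \<longrightarrow> S = T) \<and>
     (\<forall>S\<in>comps M. exc M S = 2 \<longrightarrow> odd_span (set_mset M) (S \<inter> {Zero_bar}) (wedges M S))"

section \<open>Sides, parity and the condition (C3)\<close>

text \<open>Along the path the side changes exactly at the crossing edges. Since the edges of a path
  are distinct, counting them as a set loses nothing.\<close>

lemma path_parity:
  "is_path (sub F) vs es \<Longrightarrow>
    odd (card {e \<in> set es. cross e}) \<longleftrightarrow> (hd vs \<in> A) \<noteq> (last vs \<in> A)"
proof (induction es arbitrary: vs)
  case Nil
  then obtain v where "vs = [v]" by (auto simp: is_path_def length_Suc_conv)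
  then show ?case by simp
next
  case (Cons a es)
  then obtain v ws where vs: "vs = v # ws" by (cases vs) (auto simp: is_path_def)
  with Cons.prems have p: "is_path (sub F) ws es" and a: "ends R a = Upair v (hd ws)"
    by (auto simp: is_path_Cons)
  have ws: "ws \<noteq> []" using p by (rule is_path_nonempty)
  have na: "a \<notin> set es" using is_path_distinct_edges[OF Cons.prems] by simp
  have c: "cross a \<longleftrightarrow> (v \<in> A) \<noteq> (hd ws \<in> A)" using a by (auto simp: cross_def)
  show ?case
  proof (cases "cross a")
    case True
    then have "{e \<in> set (a # es). cross e} = insert a {e \<in> set es. cross e}" by auto
    then have "card {e \<in> set (a # es). cross e} = Suc (card {e \<in> set es. cross e})"
      using na by simp
    then show ?thesis using Cons.IH[OF p] True c vs ws by simp
  next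
    case False
    then have "{e \<in> set (a # es). cross e} = {e \<in> set es. cross e}" by auto
    then show ?thesis using Cons.IH[OF p] False c vs ws by simp
  qed
qed

lemma same_side_path:
  assumes "\<forall>e\<in>F. \<not> cross e" "is_path (sub F) vs es"
  shows "hd vs \<in> A \<longleftrightarrow> last vs \<in> A"
proof -
  have "{e \<in> set es. cross e} = {}" using assms by (auto simp: is_path_spanning)
  with path_parity[OF assms(2)] show ?thesis by (metis card.empty even_zero)
qed

text \<open>Any competing path visits the two end vertices of the given one, hence contains all its
  edges by \<open>forest_path_subset\<close>. Conversely, oddness makes a shortest path nontrivial,
  so its ends are the prescribed ones.\<close>

lemma odd_span_iff:
  assumes "forest F"
  shows "odd_span F U W \<longleftrightarrow> (\<exists>vs es. shortest_path_containing (sub F) U W vs es \<and>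
    odd (card {e \<in> set es. cross e}))"
proof
  assume "odd_span F U W"
  then obtain vs es where p: "is_path (sub F) vs es" "U \<subseteq> set vs" "W \<subseteq> set es"
    "hd vs \<in> U \<union> ends_of W" "last vs \<in> U \<union> ends_of W" "(hd vs \<in> A) \<noteq> (last vs \<in> A)"
    unfolding odd_span_def by blast
  have "length es \<le> length fs" if q: "is_path (sub F) ws fs" "U \<subseteq> set ws" "W \<subseteq> set fs" for ws fs
  proof -
    have "ends_of W \<subseteq> set ws" using is_path_ends_subset[OF q(1)] q(3) by fastforce
    then have "set es \<subseteq> set fs" using forest_path_subset[OF assms p(1) q(1)] p(4,5) q(2) by blast
    then have "card (set es) \<le> card (set fs)" by (simp add: card_mono)
    then show ?thesis
      using distinct_card[OF is_path_distinct_edges[OF p(1)]]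
        distinct_card[OF is_path_distinct_edges[OF q(1)]] by simp
  qed
  then have "shortest_path_containing (sub F) U W vs es"
    using p by (auto simp: shortest_path_containing_def)
  then show "\<exists>vs es. shortest_path_containing (sub F) U W vs es \<and>
      odd (card {e \<in> set es. cross e})"
    using path_parity[OF p(1)] p(6) by blast
next
  assume "\<exists>vs es. shortest_path_containing (sub F) U W vs es \<and> odd (card {e \<in> set es. cross e})"
  then obtain vs es where s: "shortest_path_containing (sub F) U W vs es"
    and o: "odd (card {e \<in> set es. cross e})" by blast
  have ne: "es \<noteq> []" using o by (cases es) auto
  have p: "is_path (sub F) vs es" "U \<subseteq> set vs" "W \<subseteq> set es"
    using s by (auto simp: shortest_path_containing_def)
  show "odd_span F U W"
    unfolding odd_span_def
    using p path_parity[OF p(1)] o shortest_path_containing_hd[OF s ne]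
      shortest_path_containing_last[OF s ne]
    by (intro exI[of _ vs] exI[of _ es]) simp
qed

lemma odd_span_mono: "odd_span F U W \<Longrightarrow> F \<subseteq> F' \<Longrightarrow> odd_span F' U W"
proof -
  assume "F \<subseteq> F'"
  then have "is_path (sub F) vs es \<Longrightarrow> is_path (sub F') vs es" for vs es
    by (auto simp: is_path_spanning)
  then show "odd_span F U W \<Longrightarrow> odd_span F' U W" unfolding odd_span_def by blast
qed

lemma odd_span_cross:
  assumes "odd_span F U W"
  obtains e where "e \<in> F" "cross e"
proof -
  from assms obtain vs es where "is_path (sub F) vs es" "(hd vs \<in> A) \<noteq> (last vs \<in> A)"
    unfolding odd_span_def by blast
  with same_side_path[of F vs es] that show thesis by blast
qed

section \<open>Excess weight under changes of the multiset and of the vertex set\<close>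

lemma finite_edges_within [simp]: "finite (edges_within S)"
  using finite_E by (simp add: edges_within_def)

lemma edges_within_mono: "S \<subseteq> T \<Longrightarrow> edges_within S \<subseteq> edges_within T"
  by (auto simp: edges_within_def)

lemma edges_within_disjoint: "S \<inter> T = {} \<Longrightarrow> edges_within S \<inter> edges_within T = {}"
proof -
  assume "S \<inter> T = {}"
  \<comment> \<open>Every edge has an end, so none can lie within two disjoint sets.\<close>
  moreover have "\<exists>x. x \<in> set_uprod u" for u :: "'v bvert uprod" by (cases u) auto
  ultimately show ?thesis unfolding edges_within_def by blast
qed

lemma edge_within_cmp_iff:
  assumes "e \<in> F" "F \<subseteq> E" "ends R e = Upair a b" "S \<in> cmp F ` V"
  shows "e \<in> edges_within S \<longleftrightarrow> a \<in> S"
proof -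
  obtain v where S: "S = cmp F v" using assms(4) by auto
  have "(a, b) \<in> conn F" using assms conn_edge by blast
  then have "b \<in> cmp F v" if "a \<in> cmp F v" using that conn_trans[of v a F b] by (simp add: cmp_def)
  then show ?thesis using assms S by (auto simp: edges_within_def)
qed

lemma comps_disjoint: "S \<in> cmp F ` V \<Longrightarrow> T \<in> cmp F ` V \<Longrightarrow> S \<noteq> T \<Longrightarrow> S \<inter> T = {}"
  using cmp_eqI[of S F] cmp_eqI[of T F] by (metis disjoint_iff)

text \<open>The first copy of an edge carries no excess; only a further copy does, hence the
  condition \<open>e \<in># M\<close>.\<close>

lemma exc_add_mset:
  "exc (add_mset e M) S = exc M S + of_bool (e \<in> edges_within S \<and> e \<in># M)"
proof -
  have "(\<Sum>x\<in>edges_within S. count (add_mset e M) x - 1) =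
      (\<Sum>x\<in>edges_within S. count M x - 1 + (if x = e then of_bool (e \<in># M) else 0))"
    by (intro sum.cong) (auto simp: not_in_iff Suc_le_eq)
  also have "\<dots> = (\<Sum>x\<in>edges_within S. count M x - 1) + of_bool (e \<in> edges_within S \<and> e \<in># M)"
    by (simp add: sum.distrib)
  finally show ?thesis by (simp add: exc_def)
qed

lemma wedges_add_mset:
  "wedges (add_mset e M) S = wedges M S \<union> (if e \<in> edges_within S \<and> e \<in># M then {e} else {})"
proof -
  have "2 \<le> count (add_mset e M) x \<longleftrightarrow> 2 \<le> count M x \<or> x = e \<and> e \<in># M" for x
    by (cases "e \<in># M") (auto simp: not_in_iff Suc_le_eq)
  then show ?thesis by (auto simp: wedges_def)
qed

text \<open>At most one of the disjoint sets contains \<open>Zero_bar\<close>, and no edge lies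
  within both. This rules out that a component of excess at most 2 splits into two of excess
  2.\<close>

lemma exc_superadd:
  assumes "S1 \<inter> S2 = {}" "S1 \<subseteq> S" "S2 \<subseteq> S"
  shows "exc M S1 + exc M S2 \<le> exc M S"
proof -
  have "(\<Sum>e\<in>edges_within S1. count M e - 1) + (\<Sum>e\<in>edges_within S2. count M e - 1) =
      (\<Sum>e\<in>edges_within S1 \<union> edges_within S2. count M e - 1)"
    using edges_within_disjoint[OF assms(1)] by (simp add: sum.union_disjoint)
  also have "\<dots> \<le> (\<Sum>e\<in>edges_within S. count M e - 1)"
    using edges_within_mono assms by (intro sum_mono2) auto
  finally show ?thesis using assms by (auto simp: exc_def)
qed

lemma exc_mono: "S \<subseteq> T \<Longrightarrow> exc M S \<le> exc M T"
  using exc_superadd[of S "{}" T M] by simp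

text \<open>Both summands of \<open>exc\<close> are monotone, so equal totals force equality in
  each. Hence shrinking a component without losing excess keeps the data that enter (C3).\<close>

lemma exc_eq_subset:
  assumes "S \<subseteq> T" "exc M S = exc M T"
  shows "S \<inter> {Zero_bar} = T \<inter> {Zero_bar} \<and> wedges M S = wedges M T"
proof -
  let ?s = "\<lambda>X. \<Sum>e\<in>edges_within X. count M e - 1"
  have le: "?s S \<le> ?s T" using edges_within_mono[OF assms(1)] by (intro sum_mono2) auto
  have z: "Zero_bar \<in> S \<longleftrightarrow> Zero_bar \<in> T" and eq: "?s S = ?s T"
    using assms le by (auto simp: exc_def of_bool_def split: if_splits)
  have "?s T = ?s S + (\<Sum>e\<in>edges_within T - edges_within S. count M e - 1)"
    using edges_within_mono[OF assms(1)] by (simp add: sum.subset_diff)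
  with eq have "\<forall>e\<in>edges_within T - edges_within S. count M e - 1 = 0" by simp
  then have "e \<in> edges_within S" if "e \<in> edges_within T" "2 \<le> count M e" for e
    using that by force
  then have "wedges M S = wedges M T"
    using edges_within_mono[OF assms(1)] by (auto simp: wedges_def)
  with z show ?thesis by blast
qed

text \<open>Prepares the merging of two components by a new edge of multiplicity 1: before it is
  added, no edge of \<open>M\<close> runs between them.\<close>

lemma exc_Un:
  assumes "set_mset M \<subseteq> E" "S \<in> comps M" "T \<in> comps M" "S \<noteq> T"
  shows "exc M (S \<union> T) = exc M S + exc M T \<and> wedges M (S \<union> T) = wedges M S \<union> wedges M T"
proof -
  have d: "S \<inter> T = {}" using assms comps_disjoint by blast
  have sub: "edges_within S \<union> edges_within T \<subseteq> edges_within (S \<union> T)"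
    using edges_within_mono[of S "S \<union> T"] edges_within_mono[of T "S \<union> T"] by auto
  \<comment> \<open>The ambient graph may have edges between \<open>S\<close> and \<open>T\<close>,
    but \<open>M\<close> contains none of them.\<close>
  have new: "count M e = 0" if "e \<in> edges_within (S \<union> T) - (edges_within S \<union> edges_within T)" for e
  proof (rule ccontr)
    assume "count M e \<noteq> 0"
    then have e: "e \<in># M" by (simp add: not_in_iff)
    obtain a b where ab: "ends R e = Upair a b" by (cases "ends R e") auto
    have "a \<in> S \<or> a \<in> T" using that ab by (auto simp: edges_within_def)
    with that show False
      using edge_within_cmp_iff[OF e assms(1) ab assms(2)] edge_within_cmp_iff[OF e assms(1) ab assms(3)]
      by auto
  qed
  have "(\<Sum>e\<in>edges_within (S \<union> T). count M e - 1) =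
      (\<Sum>e\<in>edges_within S \<union> edges_within T. count M e - 1)"
    using sub new by (intro sum.mono_neutral_right) auto
  also have "\<dots> = (\<Sum>e\<in>edges_within S. count M e - 1) + (\<Sum>e\<in>edges_within T. count M e - 1)"
    using edges_within_disjoint[OF d] by (simp add: sum.union_disjoint)
  finally have "exc M (S \<union> T) = exc M S + exc M T" using d by (auto simp: exc_def)
  moreover have "wedges M (S \<union> T) = wedges M S \<union> wedges M T"
    using sub new unfolding wedges_def by force
  ultimately show ?thesis by blast
qed

text \<open>Double counting: \<open>Zero_bar\<close> and every edge of \<open>M\<close> lie in
  exactly one component, so the total excess is 1 plus the number of surplus copies of
  edges.\<close>

lemma sum_exc:
  assumes "set_mset M \<subseteq> E"
  shows "card (set_mset M) + (\<Sum>S\<in>comps M. exc M S) = Suc (size M)"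
proof -
  let ?F = "set_mset M"
  have one: "(\<Sum>S\<in>comps M. of_bool (v \<in> S)) = (1::nat)" if "v \<in> V" for v
  proof -
    have "(\<Sum>S\<in>comps M. of_bool (v \<in> S)) = (\<Sum>S\<in>comps M. if S = cmp ?F v then 1 else (0::nat))"
    proof (rule sum.cong)
      fix S assume "S \<in> comps M"
      then have "v \<in> S \<longleftrightarrow> S = cmp ?F v" using cmp_eqI[of S ?F v] cmp_refl[of v ?F] by blast
      then show "of_bool (v \<in> S) = (if S = cmp ?F v then 1 else (0::nat))" by simp
    qed simp
    also have "\<dots> = 1" using that finite_V by simp
    finally show ?thesis .
  qed
  have "exc M S = of_bool (Zero_bar \<in> S) + (\<Sum>e\<in>?F. of_bool (e \<in> edges_within S) * (count M e - 1))" for S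
  proof -
    have "(\<Sum>e\<in>?F. of_bool (e \<in> edges_within S) * (count M e - 1)) =
        (\<Sum>e\<in>edges_within S. count M e - 1)"
      by (rule sum.mono_neutral_cong) (auto simp: not_in_iff)
    then show ?thesis by (simp add: exc_def)
  qed
  then have "(\<Sum>S\<in>comps M. exc M S) =
      1 + (\<Sum>S\<in>comps M. \<Sum>e\<in>?F. of_bool (e \<in> edges_within S) * (count M e - 1))"
    using one[OF root] by (simp add: sum.distrib)
  also have "(\<Sum>S\<in>comps M. \<Sum>e\<in>?F. of_bool (e \<in> edges_within S) * (count M e - 1)) =
      (\<Sum>e\<in>?F. \<Sum>S\<in>comps M. of_bool (e \<in> edges_within S) * (count M e - 1))"
    by (rule sum.swap)
  also have "\<dots> = (\<Sum>e\<in>?F. count M e - 1)"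
  proof (rule sum.cong)
    fix e assume e: "e \<in> ?F"
    obtain a b where ab: "ends R e = Upair a b" by (cases "ends R e") auto
    have a: "a \<in> V" using e assms ab edge_vertsD by blast
    have "(\<Sum>S\<in>comps M. of_bool (e \<in> edges_within S) * (count M e - 1)) =
        (\<Sum>S\<in>comps M. of_bool (a \<in> S)) * (count M e - 1)"
      unfolding sum_distrib_right
      by (intro sum.cong) (auto simp: edge_within_cmp_iff[OF e assms ab])
    then show "(\<Sum>S\<in>comps M. of_bool (e \<in> edges_within S) * (count M e - 1)) = count M e - 1"
      using one[OF a] by simp
  qed simp
  finally have "card ?F + (\<Sum>S\<in>comps M. exc M S) = Suc (\<Sum>e\<in>?F. 1 + (count M e - 1))"
    by (simp only: sum.distrib) simp
  moreover have "(\<Sum>e\<in>?F. 1 + (count M e - 1)) = size M"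
    unfolding size_multiset_overloaded_eq
  proof (rule sum.cong)
    fix e assume "e \<in> ?F"
    then have "count M e > 0" by simp
    then show "1 + (count M e - 1) = count M e" by simp
  qed simp
  ultimately show ?thesis by simp
qed

lemma cmp_mono_comps:
  assumes "F \<subseteq> F'" "S \<in> cmp F ` V"
  obtains T where "T \<in> cmp F' ` V" "S \<subseteq> T"
  using assms cmp_mono[OF assms(1)] by blast

lemma wedges_subset: "wedges M S \<subseteq> set_mset M" "wedges M S \<subseteq> edges_within S"
proof -
  have "x \<in># M" if "2 \<le> count M x" for x
    using that by (metis count_inI not_numeral_le_zero)
  then show "wedges M S \<subseteq> set_mset M" by (auto simp: wedges_def)
  show "wedges M S \<subseteq> edges_within S" by (auto simp: wedges_def)
qed

lemma ends_of_wedges: "ends_of (wedges M S) \<subseteq> S"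
  using wedges_subset(2)[of M S] unfolding edges_within_def by blast

lemma goodD:
  assumes "good M"
  shows "set_mset M \<subseteq> E" "forest (set_mset M)"
    "S \<in> comps M \<Longrightarrow> exc M S \<le> 2"
    "S \<in> comps M \<Longrightarrow> T \<in> comps M \<Longrightarrow> exc M S = 2 \<Longrightarrow> exc M T = 2 \<Longrightarrow> S = T"
    "S \<in> comps M \<Longrightarrow> exc M S = 2 \<Longrightarrow> odd_span (set_mset M) (S \<inter> {Zero_bar}) (wedges M S)"
proof -
  note g = assms[unfolded good_def]
  show "set_mset M \<subseteq> E" "forest (set_mset M)" using g by simp_all
  show "S \<in> comps M \<Longrightarrow> exc M S \<le> 2"
    using g by (elim conjE) (rule bspec)
  show "S \<in> comps M \<Longrightarrow> T \<in> comps M \<Longrightarrow> exc M S = 2 \<Longrightarrow> exc M T = 2 \<Longrightarrow> S = T"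
    using g by (elim conjE) (drule (1) bspec, drule (1) bspec, iprover)
  show "S \<in> comps M \<Longrightarrow> exc M S = 2 \<Longrightarrow> odd_span (set_mset M) (S \<inter> {Zero_bar}) (wedges M S)"
    using g by (elim conjE) (drule (1) bspec, iprover)
qed

section \<open>Closure under submultisets\<close>

text \<open>A copy of \<open>e\<close> remains, so forest and components stay the same and no excess
  grows. A component that still has excess 2 cannot contain \<open>e\<close>, as it would have had
  excess 3 before.\<close>

lemma good_remove_member:
  assumes g: "good (add_mset e N)" and e: "e \<in># N"
  shows "good N"
proof -
  have F: "set_mset (add_mset e N) = set_mset N" using e by auto
  have le: "exc N S \<le> exc (add_mset e N) S" for S by (simp add: exc_add_mset)
  have b: "exc (add_mset e N) S \<le> 2" if "S \<in> comps N" for S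
    using goodD(3)[OF g, of S] that by (simp only: F)
  have two: "exc (add_mset e N) S = 2 \<and> wedges (add_mset e N) S = wedges N S"
    if "S \<in> comps N" "exc N S = 2" for S
  proof -
    have "e \<notin> edges_within S" using b[OF that(1)] that(2) e by (auto simp: exc_add_mset)
    then show ?thesis using that(2) by (simp add: exc_add_mset wedges_add_mset)
  qed
  show ?thesis
    unfolding good_def
  proof (intro conjI ballI impI)
    show "set_mset N \<subseteq> E" "forest (set_mset N)" using goodD(1,2)[OF g] by (simp_all only: F)
    show "exc N S \<le> 2" if "S \<in> comps N" for S using b[OF that] le[of S] by simp
    show "S = T" if "S \<in> comps N" "T \<in> comps N" "exc N S = 2" "exc N T = 2" for S T
      using goodD(4)[OF g, of S T] that two[of S] two[of T] by (simp only: F)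
    show "odd_span (set_mset N) (S \<inter> {Zero_bar}) (wedges N S)" if "S \<in> comps N" "exc N S = 2" for S
      using goodD(5)[OF g, of S] that two[OF that] by (simp only: F)
  qed
qed

text \<open>The only copy of \<open>e\<close> disappears. It carried no excess, so
  \<open>exc\<close> and \<open>wedges\<close> keep their values on every vertex set; what changes
  is that a component splits.\<close>

lemma good_remove_nonmember:
  assumes g: "good (add_mset e N)" and e: "e \<notin># N"
  shows "good N"
proof -
  let ?F = "set_mset (add_mset e N)" and ?F' = "set_mset N"
  have FE: "?F \<subseteq> E" and fo: "forest ?F" using goodD(1,2)[OF g] .
  have F'F: "?F' \<subseteq> ?F" by auto
  have ex: "exc (add_mset e N) S = exc N S" "wedges (add_mset e N) S = wedges N S" for S
    using e by (simp_all add: exc_add_mset wedges_add_mset)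
  have b: "exc N S \<le> 2" if "S \<in> cmp ?F ` V" for S
    using goodD(3)[OF g that] by (simp only: ex)
  have u: "S = T" if "S \<in> cmp ?F ` V" "T \<in> cmp ?F ` V" "exc N S = 2" "exc N T = 2" for S T
    using goodD(4)[OF g that(1,2)] that(3,4) by (simp only: ex)
  have o: "odd_span ?F (S \<inter> {Zero_bar}) (wedges N S)" if "S \<in> cmp ?F ` V" "exc N S = 2" for S
    using goodD(5)[OF g that(1)] that(2) by (simp only: ex)
  show ?thesis
    unfolding good_def
  proof (intro conjI ballI impI)
    show F'E: "?F' \<subseteq> E" using FE by auto
    show "forest ?F'" using forest_mono[OF fo F'F] .
    show le: "exc N S' \<le> 2" if S': "S' \<in> comps N" for S'
    proof -
      obtain S where S: "S \<in> cmp ?F ` V" "S' \<subseteq> S" by (rule cmp_mono_comps[OF F'F S'])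
      then show ?thesis using exc_mono[OF S(2), of N] b[OF S(1)] by simp
    qed
    show "S' = T'" if S': "S' \<in> comps N" and T': "T' \<in> comps N" and 2: "exc N S' = 2" "exc N T' = 2" for S' T'
    proof (rule ccontr)
      assume "S' \<noteq> T'"
      then have d: "S' \<inter> T' = {}" using comps_disjoint[OF S' T'] by blast
      obtain S where S: "S \<in> cmp ?F ` V" "S' \<subseteq> S" by (rule cmp_mono_comps[OF F'F S'])
      \<comment> \<open>Two parts of excess 2 would lie in the same old component and give it excess
        at least 4.\<close>
      obtain T where T: "T \<in> cmp ?F ` V" "T' \<subseteq> T" by (rule cmp_mono_comps[OF F'F T'])
      have "exc N S = 2" using exc_mono[OF S(2), of N] b[OF S(1)] 2 by simp
      moreover have "exc N T = 2" using exc_mono[OF T(2), of N] b[OF T(1)] 2 by simp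
      ultimately have "S = T" using u S T by blast
      then have "exc N S' + exc N T' \<le> exc N S" using d S T by (intro exc_superadd) auto
      with 2 b[OF S(1)] show False by simp
    qed
    show "odd_span ?F' (S' \<inter> {Zero_bar}) (wedges N S')" if S': "S' \<in> comps N" and 2: "exc N S' = 2" for S'
    proof -
      obtain S where S: "S \<in> cmp ?F ` V" "S' \<subseteq> S" by (rule cmp_mono_comps[OF F'F S'])
      have S2: "exc N S = 2" using exc_mono[OF S(2), of N] b[OF S(1)] 2 by simp
      have eq: "S' \<inter> {Zero_bar} = S \<inter> {Zero_bar}" "wedges N S' = wedges N S"
        using exc_eq_subset[OF S(2), of N] S2 2 by auto
      from o[OF S(1) S2] obtain vs es where p: "is_path (sub ?F) vs es"
        "S' \<inter> {Zero_bar} \<subseteq> set vs" "wedges N S' \<subseteq> set es"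
        "hd vs \<in> (S' \<inter> {Zero_bar}) \<union> ends_of (wedges N S')"
        "last vs \<in> (S' \<inter> {Zero_bar}) \<union> ends_of (wedges N S')"
        "(hd vs \<in> A) \<noteq> (last vs \<in> A)"
        unfolding odd_span_def eq by blast
      have inS: "hd vs \<in> S'" "last vs \<in> S'" using p(4,5) ends_of_wedges[of N S'] by blast+
      have hdV: "hd vs \<in> V" using p(1) is_path_nonempty[OF p(1)] by (auto simp: is_path_spanning)
      have "cmp ?F' (hd vs) = S'" using cmp_eqI[OF S' inS(1)] by simp
      then have "(hd vs, last vs) \<in> conn ?F'" using inS(2) by (auto simp: cmp_def)
      then obtain ws fs where q: "is_path (sub ?F') ws fs" "hd ws = hd vs" "last ws = last vs"
        using conn_path[OF F'E hdV, of "last vs"] by blast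
      have wne: "ws \<noteq> []" using q(1) by (rule is_path_nonempty)
      have fs: "set fs \<subseteq> ?F'" using q(1) by (auto simp: is_path_spanning)
      \<comment> \<open>The ends of the old path are still connected without \<open>e\<close>. As
        paths in the larger forest are unique, the old path already avoided
        \<open>e\<close>.\<close>
      have "is_path (sub ?F) ws fs" using path_mono[OF q(1)] fs F'F by blast
      then have "set es \<subseteq> set fs"
        using forest_path_subset[OF fo p(1), of ws fs] wne q(2,3) by (metis hd_in_set last_in_set)
      then have "is_path (sub ?F') vs es" using path_mono[OF p(1)] fs by blast
      with p show ?thesis unfolding odd_span_def by blast
    qed
  qed
qed

lemma good_subset_mset:
  assumes "good M" "N \<subseteq># M"
  shows "good N"
proof -
  obtain K where "M = N + K" using assms(2) by (auto simp: mset_subset_eq_exists_conv)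
  with assms(1) show ?thesis
  proof (induction K arbitrary: M)
    case (add e K)
    then have "good (add_mset e (N + K))" by simp
    then have "good (N + K)" using good_remove_member good_remove_nonmember by blast
    then show ?case by (rule add.IH) simp
  qed simp
qed

section \<open>Extending a 2-weighted forest by one edge\<close>

text \<open>The components stay and only the excess of \<open>S\<close> grows, by one. The
  assumption \<open>one\<close> covers the case in which it reaches 2: then uniqueness of such a
  component and (C3) are at stake.\<close>

lemma good_raise:
  assumes g: "good M" and e: "e \<in># M" and S: "S \<in> comps M" "e \<in> edges_within S" "exc M S \<le> 1"
    and one: "exc M S = 1 \<Longrightarrow> (\<forall>T\<in>comps M. exc M T \<le> 1) \<and>
      odd_span (set_mset M) (S \<inter> {Zero_bar}) (wedges (add_mset e M) S)"
  shows "good (add_mset e M)"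
proof -
  have F: "set_mset (add_mset e M) = set_mset M" using e by auto
  have FE: "set_mset M \<subseteq> E" and fo: "forest (set_mset M)" using goodD(1,2)[OF g] .
  have exS: "exc (add_mset e M) S = Suc (exc M S)" using S e by (simp add: exc_add_mset)
  have notin: "e \<notin> edges_within T" if "T \<in> comps M" "T \<noteq> S" for T
    using edges_within_disjoint[OF comps_disjoint[OF that(1) S(1) that(2)]] S(2) by blast
  have exT: "exc (add_mset e M) T = exc M T" "wedges (add_mset e M) T = wedges M T"
    if "T \<in> comps M" "T \<noteq> S" for T
    using notin[OF that] by (simp_all add: exc_add_mset wedges_add_mset)
  show ?thesis
    unfolding good_def F
  proof (intro conjI ballI impI)
    show "set_mset M \<subseteq> E" "forest (set_mset M)" by fact+
    show "exc (add_mset e M) T \<le> 2" if "T \<in> comps M" for T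
      using exT(1)[OF that] exS S(3) goodD(3)[OF g that] by (cases "T = S") auto
    have key: "T = S \<and> exc M S = 1 \<or> exc M T = 2 \<and> T \<noteq> S"
      if "T \<in> comps M" "exc (add_mset e M) T = 2" for T
      using exT(1)[OF that(1)] exS that by (cases "T = S") auto
    show "T = X" if "T \<in> comps M" "X \<in> comps M" "exc (add_mset e M) T = 2"
      "exc (add_mset e M) X = 2" for T X
    proof -
      have "T = X" if "exc M T = 2" "exc M X = 2"
        using goodD(4)[OF g \<open>T \<in> comps M\<close> \<open>X \<in> comps M\<close> that] .
      moreover have "exc M T \<noteq> 2 \<and> exc M X \<noteq> 2" if "exc M S = 1"
        using bspec[OF conjunct1[OF one[OF that]] \<open>T \<in> comps M\<close>]
          bspec[OF conjunct1[OF one[OF that]] \<open>X \<in> comps M\<close>] by simp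
      ultimately show ?thesis using key[OF that(1,3)] key[OF that(2,4)] by blast
    qed
    show "odd_span (set_mset M) (T \<inter> {Zero_bar}) (wedges (add_mset e M) T)"
      if "T \<in> comps M" "exc (add_mset e M) T = 2" for T
    proof (cases "T = S")
      case True
      then show ?thesis using key[OF that] one by blast
    next
      case False
      then have "exc M T = 2" using key[OF that] by blast
      then show ?thesis using goodD(5)[OF g that(1)] exT(2)[OF that(1) False] by simp
    qed
  qed
qed

text \<open>The new edge has multiplicity 1, so the merged component has the sum of the two excesses
  and the union of the weighted edges. The assumption \<open>two\<close> supplies uniqueness and
  (C3) when this sum is 2.\<close>

lemma good_merge:
  assumes g: "good M" and e: "e \<in> E" "ends R e = Upair a b" "(a, b) \<notin> conn (set_mset M)"
    and S: "S = cmp (set_mset M) a" and T: "T = cmp (set_mset M) b"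
    and le: "exc M S + exc M T \<le> 2"
    and two: "exc M S + exc M T = 2 \<Longrightarrow>
      (\<forall>X\<in>comps M. X \<noteq> S \<longrightarrow> X \<noteq> T \<longrightarrow> exc M X \<le> 1) \<and>
      odd_span (insert e (set_mset M)) ((S \<union> T) \<inter> {Zero_bar}) (wedges M S \<union> wedges M T)"
  shows "good (add_mset e M)"
proof -
  let ?F = "set_mset M"
  have FE: "?F \<subseteq> E" and fo: "forest ?F" using goodD(1,2)[OF g] .
  have F: "set_mset (add_mset e M) = insert e ?F" by simp
  have ab: "a \<in> V" "b \<in> V" using e edge_vertsD by auto
  have ST: "S \<in> comps M" "T \<in> comps M" "S \<noteq> T" using ab e(3) S T by (auto simp: cmp_eq_iff)
  have nm: "e \<notin># M" using conn_edge[of e ?F a b] e by blast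
  have ex: "exc (add_mset e M) X = exc M X" "wedges (add_mset e M) X = wedges M X" for X
    using nm by (simp_all add: exc_add_mset wedges_add_mset)
  have exU: "exc M (S \<union> T) = exc M S + exc M T" "wedges M (S \<union> T) = wedges M S \<union> wedges M T"
    using exc_Un[OF FE ST] by auto
  have cs: "X = S \<union> T \<or> X \<in> comps M \<and> X \<noteq> S \<and> X \<noteq> T" if "X \<in> cmp (insert e ?F) ` V" for X
    using that unfolding components_insert[OF e(2,1)] S T by blast
  show ?thesis
    unfolding good_def F ex
  proof (intro conjI ballI impI)
    show "insert e ?F \<subseteq> E" using FE e by blast
    show "forest (insert e ?F)" by (rule forest_insert[OF fo e(2,3)])
    show "exc M X \<le> 2" if "X \<in> cmp (insert e ?F) ` V" for X
      using cs[OF that] le exU(1) goodD(3)[OF g, of X] by auto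
    show "X = Y" if "X \<in> cmp (insert e ?F) ` V" "Y \<in> cmp (insert e ?F) ` V" "exc M X = 2" "exc M Y = 2" for X Y
    proof -
      have "X = Y" if "X \<in> comps M" "Y \<in> comps M"
        using goodD(4)[OF g that] \<open>exc M X = 2\<close> \<open>exc M Y = 2\<close> by blast
      moreover have "Z = S \<union> T" if "exc M (S \<union> T) = 2" "exc M Z = 2" "Z \<in> cmp (insert e ?F) ` V" for Z
      proof (rule ccontr)
        assume "Z \<noteq> S \<union> T"
        moreover have "exc M S + exc M T = 2" using that(1) exU(1) by simp
        ultimately have "exc M Z \<le> 1" using cs[OF that(3)] two by blast
        with that(2) show False by simp
      qed
      ultimately show ?thesis using cs[OF that(1)] cs[OF that(2)] that by blast
    qed
    show "odd_span (insert e ?F) (X \<inter> {Zero_bar}) (wedges M X)"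
      if "X \<in> cmp (insert e ?F) ` V" "exc M X = 2" for X
    proof (cases "X = S \<union> T")
      case True
      then show ?thesis using two that exU by simp
    next
      case False
      then have "X \<in> comps M" using cs[OF that(1)] by blast
      then have "odd_span ?F (X \<inter> {Zero_bar}) (wedges M X)" using goodD(5)[OF g] that(2) by blast
      then show ?thesis by (rule odd_span_mono) blast
    qed
  qed
qed

lemma exc_eq_1_cases:
  assumes "exc M S = 1"
  obtains "Zero_bar \<in> S" "wedges M S = {}" | a where "Zero_bar \<notin> S" "wedges M S = {a}"
proof (cases "Zero_bar \<in> S")
  case True
  then have "(\<Sum>e\<in>edges_within S. count M e - 1) = 0" using assms by (simp add: exc_def)
  then have "count M e \<le> 1" if "e \<in> edges_within S" for e using that by simp
  then have "\<not> 2 \<le> count M e" if "e \<in> edges_within S" for e using that by fastforce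
  then have "wedges M S = {}" unfolding wedges_def by blast
  with True show thesis by (rule that(1))
next
  case False
  then have "(\<Sum>e\<in>edges_within S. count M e - 1) = 1" using assms by (simp add: exc_def)
  then have "\<exists>a\<in>edges_within S. count M a - 1 = 1 \<and>
      (\<forall>b\<in>edges_within S. a \<noteq> b \<longrightarrow> count M b - 1 = 0)"
    by (simp only: sum_eq_1_iff[OF finite_edges_within])
  then obtain a where a: "a \<in> edges_within S" "count M a - 1 = 1"
    and b: "\<And>b. b \<in> edges_within S \<Longrightarrow> a \<noteq> b \<Longrightarrow> count M b - 1 = 0" by blast
  have "b = a" if "b \<in> edges_within S" "2 \<le> count M b" for b
  proof (rule ccontr)
    assume "b \<noteq> a"
    then have "count M b - 1 = 0" using b[OF that(1)] by blast
    with that(2) show False by linarith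
  qed
  moreover have "2 \<le> count M a" using a(2) by linarith
  ultimately have "wedges M S = {a}" using a(1) unfolding wedges_def by blast
  with False show thesis by (rule that(2))
qed

text \<open>The anchor of a component of excess weight 1 is \<open>Zero_bar\<close> or its unique weighted
  edge.\<close>

lemma anchor_path:
  assumes g: "good M" and S: "S \<in> comps M" "exc M S = 1" and y: "y \<in> S"
  obtains vs es where "is_path (sub (set_mset M)) vs es" "last vs = y"
    "S \<inter> {Zero_bar} \<subseteq> set vs" "wedges M S \<subseteq> set es"
    "hd vs \<in> (S \<inter> {Zero_bar}) \<union> ends_of (wedges M S)"
proof -
  let ?F = "set_mset M"
  have FE: "?F \<subseteq> E" and fo: "forest ?F" using goodD(1,2)[OF g] .
  have conn: "(x, y) \<in> conn ?F" if "x \<in> S" for x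
    using cmp_eqI[OF S(1) that] y by (simp add: cmp_def)
  from S(2) show thesis
  proof (cases rule: exc_eq_1_cases)
    case 1
    obtain vs es where p: "is_path (sub ?F) vs es" "hd vs = Zero_bar" "last vs = y"
      by (rule conn_path[OF FE root conn[OF 1(1)]])
    have "Zero_bar \<in> set vs" using is_path_nonempty[OF p(1)] p(2) hd_in_set by metis
    then show thesis using p 1 by (intro that[of vs es]) auto
  next
    case (2 a)
    have aF: "a \<in> ?F" and aS: "a \<in> edges_within S" using wedges_subset[of M S] 2(2) by auto
    obtain x x' where xx: "ends R a = Upair x x'" by (cases "ends R a") auto
    have ne: "x \<noteq> x'" using forest_edge_ends[OF fo aF xx] .
    have "x \<in> S" using aS xx by (auto simp: edges_within_def)
    then have xy: "(x, y) \<in> conn ?F" by (rule conn)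
    \<comment> \<open>Making \<open>a\<close> the first edge ensures that the path contains
      \<open>a\<close> and starts at one of its ends, whichever end is nearer to
      \<open>y\<close>.\<close>
    obtain vs es where p: "is_path (sub ?F) vs es" "es \<noteq> []" "hd es = a" "hd vs \<in> {x, x'}"
      "last vs = y"
      by (rule path_from_edge[OF FE aF xx ne xy])
    have "a \<in> set es" using p(2,3) hd_in_set by blast
    then show thesis using p 2 xx by (intro that[of vs es]) auto
  qed
qed

text \<open>The edge \<open>f\<close> shows that \<open>S\<close> meets both sides. A crossing
  weighted edge can be raised from multiplicity 2 to 3, since it alone spans both sides. Otherwise
  the anchor lies on one side, and the last edge of a path from it to a vertex of the other side is
  raised.\<close>

lemma good_extend_within:
  assumes g: "good M" and le: "\<forall>T\<in>comps M. exc M T \<le> 1"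
    and S: "S \<in> comps M" "exc M S = 1" and f: "f \<in> edges_within S" "cross f"
  shows "\<exists>e. good (add_mset e M)"
proof -
  let ?F = "set_mset M" and ?X = "(S \<inter> {Zero_bar}) \<union> ends_of (wedges M S)"
  have FE: "?F \<subseteq> E" and fo: "forest ?F" using goodD(1,2)[OF g] .
  have raise: "good (add_mset e M)"
    if "e \<in> ?F" "e \<in> edges_within S" "odd_span ?F (S \<inter> {Zero_bar}) (wedges M S \<union> {e})" for e
    using that le S by (intro good_raise[OF g, of e S]) (simp_all add: wedges_add_mset)
  obtain x y where f': "ends R f = Upair x y" "x \<in> A" "y \<notin> A" using f(2) by (auto simp: cross_def)
  have xy: "x \<in> S" "y \<in> S" using f(1) f' by (auto simp: edges_within_def)
  show ?thesis
  proof (cases "\<exists>a\<in>wedges M S. cross a")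
    case True
    then obtain a where a: "a \<in> wedges M S" "cross a" by blast
    have aF: "a \<in> ?F" and aS: "a \<in> edges_within S" using wedges_subset[of M S] a(1) by auto
    have W: "S \<inter> {Zero_bar} = {}" "wedges M S = {a}"
      using S(2) a(1) by (cases rule: exc_eq_1_cases; auto)+
    obtain p q where pq: "ends R a = Upair p q" "p \<in> A" "q \<notin> A" using a(2) by (auto simp: cross_def)
    have "p \<in> V" "q \<in> V" using edge_vertsD[of a p q] aF FE pq by auto
    then have "is_path (sub ?F) [p, q] [a]" using aF pq by (auto simp: is_path_Cons is_path_Nil)
    then have "odd_span ?F (S \<inter> {Zero_bar}) (wedges M S \<union> {a})"
      unfolding odd_span_def using W pq by (intro exI[of _ "[p, q]"] exI[of _ "[a]"]) auto
    then show ?thesis using raise[OF aF aS] by blast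
  next
    case False
    \<comment> \<open>The side of the anchor is well defined: it is a single vertex or the two ends
      of a non-crossing edge.\<close>
    have same: "u \<in> A \<longleftrightarrow> v \<in> A" if "u \<in> ?X" "v \<in> ?X" for u v
      using S(2)
    proof (cases rule: exc_eq_1_cases)
      case 1
      then show ?thesis using that by auto
    next
      case (2 a)
      obtain p q where pq: "ends R a = Upair p q" by (cases "ends R a") auto
      have "\<not> cross a" using False 2 by blast
      then have "p \<in> A \<longleftrightarrow> q \<in> A" using pq by (auto simp: cross_def Upair_inject)
      then show ?thesis using that 2 pq by auto
    qed
    \<comment> \<open>Any element of \<open>?X\<close> will do, to fix the side of the anchor; the
      path found here is not kept.\<close>
    obtain u where u: "u \<in> ?X" by (rule anchor_path[OF g S xy(1)])
    obtain v where v: "v \<in> S" "(v \<in> A) \<noteq> (u \<in> A)" using xy f' by blast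
    obtain vs es where p: "is_path (sub ?F) vs es" "last vs = v" "S \<inter> {Zero_bar} \<subseteq> set vs"
      "wedges M S \<subseteq> set es" "hd vs \<in> ?X"
      by (rule anchor_path[OF g S v(1)])
    have side: "(hd vs \<in> A) \<noteq> (last vs \<in> A)" using same[OF p(5) u] v p(2) by blast
    have ne: "es \<noteq> []"
    proof
      assume "es = []"
      then have "hd vs = last vs" using p(1) by (cases vs) (auto simp: is_path_def)
      with side show False by simp
    qed
    define e where "e = last es"
    have e: "e \<in> set es" "last vs \<in> set_uprod (ends R e)"
      using ne is_path_last_edge[OF p(1) ne] by (auto simp: e_def)
    have eF: "e \<in> ?F" using e(1) p(1) by (auto simp: is_path_spanning)
    have "e \<in> edges_within S"
    proof -
      obtain b where "ends R e = Upair v b" using e(2) p(2) by (cases "ends R e") (auto simp: Upair_inject)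
      then show ?thesis using edge_within_cmp_iff[OF eF FE _ S(1)] v(1) by blast
    qed
    moreover have "odd_span ?F (S \<inter> {Zero_bar}) (wedges M S \<union> {e})"
      unfolding odd_span_def using p e side by (intro exI[of _ vs] exI[of _ es]) auto
    ultimately show ?thesis using raise[OF eF] by blast
  qed
qed

text \<open>Without crossing edges in \<open>M\<close> every component lies on one side, so
  \<open>f\<close> joins two components whose anchors lie on the sides of \<open>x\<close> and of
  \<open>y\<close>. The two anchor paths, linked by \<open>f\<close>, give the odd path.\<close>

lemma good_extend_between:
  assumes g: "good M" and le: "\<forall>T\<in>comps M. exc M T \<le> 1"
    and f: "f \<in> E" "ends R f = Upair x y" "x \<in> A" "y \<notin> A"
    and ex: "exc M (cmp (set_mset M) x) = 1" "exc M (cmp (set_mset M) y) = 1"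
    and nc: "\<forall>e\<in>#M. \<not> cross e"
  shows "good (add_mset f M)"
proof -
  let ?F = "set_mset M"
  have FE: "?F \<subseteq> E" and fo: "forest ?F" using goodD(1,2)[OF g] .
  have xy: "x \<in> V" "y \<in> V" using edge_vertsD[OF f(1,2)] by auto
  have nconn: "(x, y) \<notin> conn ?F"
  proof
    assume "(x, y) \<in> conn ?F"
    from conn_path[OF FE xy(1) this] same_side_path[OF nc] f(3,4) show False by metis
  qed
  define S T where "S = cmp ?F x" and "T = cmp ?F y"
  have ST: "S \<in> comps M" "T \<in> comps M" "x \<in> S" "y \<in> T" "S \<noteq> T"
    using xy nconn by (auto simp: S_def T_def cmp_eq_iff)
  have d: "S \<inter> T = {}" using comps_disjoint[OF ST(1,2,5)] .
  have ex': "exc M S = 1" "exc M T = 1" using ex by (simp_all add: S_def T_def)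
  obtain vs es where p: "is_path (sub ?F) vs es" "last vs = x" "S \<inter> {Zero_bar} \<subseteq> set vs"
      "wedges M S \<subseteq> set es" "hd vs \<in> (S \<inter> {Zero_bar}) \<union> ends_of (wedges M S)"
    by (rule anchor_path[OF g ST(1) ex'(1) ST(3)])
  obtain ws fs where q: "is_path (sub ?F) ws fs" "last ws = y" "T \<inter> {Zero_bar} \<subseteq> set ws"
      "wedges M T \<subseteq> set fs" "hd ws \<in> (T \<inter> {Zero_bar}) \<union> ends_of (wedges M T)"
    by (rule anchor_path[OF g ST(2) ex'(2) ST(4)])
  have vne: "vs \<noteq> []" and wne: "ws \<noteq> []" using p(1) q(1) by (auto dest: is_path_nonempty)
  have "set vs \<subseteq> S"
    using path_conn[OF p(1), of x] last_in_set[OF vne] by (auto simp: S_def cmp_def p(2))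
  moreover have "set ws \<subseteq> T"
    using path_conn[OF q(1), of y] last_in_set[OF wne] by (auto simp: T_def cmp_def q(2))
  ultimately have dj: "set vs \<inter> set (rev ws) = {}" using d by auto
  have "is_path (sub (insert f ?F)) vs es" "is_path (sub (insert f ?F)) (rev ws) (rev fs)"
    using p(1) is_path_rev[OF q(1)] by (auto simp: is_path_spanning)
  \<comment> \<open>The second path is reversed, so that the anchors become the two outer
    ends.\<close>
  then have path: "is_path (sub (insert f ?F)) (vs @ rev ws) (es @ f # rev fs)"
    using dj f(2) p(2) q(2) wne by (intro is_path_append) (auto simp: hd_rev)
  have "hd (vs @ rev ws) \<in> A \<longleftrightarrow> x \<in> A" "last (vs @ rev ws) \<in> A \<longleftrightarrow> y \<in> A"
    using same_side_path[OF nc p(1)] same_side_path[OF nc q(1)] vne wne p(2) q(2)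
    by (auto simp: last_rev)
  then have side: "(hd (vs @ rev ws) \<in> A) \<noteq> (last (vs @ rev ws) \<in> A)" using f(3,4) by blast
  have "odd_span (insert f ?F) ((S \<union> T) \<inter> {Zero_bar}) (wedges M S \<union> wedges M T)"
    unfolding odd_span_def
  proof (intro exI conjI)
    show "is_path (sub (insert f ?F)) (vs @ rev ws) (es @ f # rev fs)" by (rule path)
    show "hd (vs @ rev ws) \<in> ((S \<union> T) \<inter> {Zero_bar}) \<union> ends_of (wedges M S \<union> wedges M T)"
      using p(5) vne by auto
    show "last (vs @ rev ws) \<in> ((S \<union> T) \<inter> {Zero_bar}) \<union> ends_of (wedges M S \<union> wedges M T)"
      using q(5) wne by (auto simp: last_rev)
  qed (use p q side in auto)
  then show ?thesis
    using ex' le by (intro good_merge[OF g f(1,2) nconn S_def T_def]) auto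
qed

section \<open>The size of a maximal 2-weighted forest\<close>

text \<open>Loops at \<open>v\<close> are allowed, as they never occur in a forest.
  \<open>Zero_bar\<close> is left out because its component always has positive excess.\<close>

definition isolated :: "'v bvert set" where
  "isolated = {v \<in> V. v \<noteq> Zero_bar \<and>
     (\<forall>e\<in>E. \<forall>w. ends R e = Upair v w \<longrightarrow> w = v)}"

lemma cmp_eq_singleton:
  assumes "forest F" "\<And>e w. e \<in> F \<Longrightarrow> ends R e = Upair v w \<Longrightarrow> w = v"
  shows "cmp F v = {v}"
proof -
  have "w = v" if "(v, w) \<in> conn F" for w
    using that unfolding conn_def
  proof (cases rule: converse_rtranclE)
    case (step u)
    then obtain e where "e \<in> F" "ends R e = Upair v u" by (auto simp: adj_def)
    then show ?thesis using assms(2) forest_edge_ends[OF assms(1)] by blast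
  qed simp
  then show ?thesis by (auto simp: cmp_def)
qed

lemma isolated_comp:
  assumes g: "good M" and v: "v \<in> isolated"
  shows "{v} \<in> comps M \<and> exc M {v} = 0"
proof -
  have FE: "set_mset M \<subseteq> E" and fo: "forest (set_mset M)" using goodD(1,2)[OF g] .
  have vV: "v \<in> V" and v0: "v \<noteq> Zero_bar" using v by (auto simp: isolated_def)
  have c: "cmp (set_mset M) v = {v}"
    using v FE by (intro cmp_eq_singleton[OF fo]) (auto simp: isolated_def)
  have "count M e - 1 = 0" if "e \<in> edges_within {v}" for e
  proof -
    have "ends R e = Upair v v" using that by (cases "ends R e") (auto simp: edges_within_def)
    then have "e \<notin># M" using forest_edge_ends[OF fo] by blast
    then show ?thesis by (simp add: not_in_iff)
  qed
  then have "exc M {v} = 0" using v0 by (simp add: exc_def)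
  moreover have "{v} \<in> comps M" using c vV by (metis imageI)
  ultimately show ?thesis by blast
qed

text \<open>An edge of \<open>M\<close> in \<open>S\<close> could be raised, so \<open>S\<close> is
  a single vertex \<open>v\<close>. A non-loop edge at \<open>v\<close> could be added: attaching a
  component of excess 0 changes neither the excess nor the weighted edges of the other component, so
  its odd path survives.\<close>

lemma maximal_exc_0:
  assumes g: "good M" and m: "\<nexists>e. good (add_mset e M)" and S: "S \<in> comps M" "exc M S = 0"
  shows "\<exists>v\<in>isolated. S = {v}"
proof -
  let ?F = "set_mset M"
  have FE: "?F \<subseteq> E" and fo: "forest ?F" using goodD(1,2)[OF g] .
  have no: "e \<notin> edges_within S" if "e \<in># M" for e
    using good_raise[OF g that S(1)] S(2) m by auto
  obtain v where v: "v \<in> V" "S = cmp ?F v" using S(1) by blast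
  have vS: "v \<in> S" using v by simp
  have nedge: "e \<notin># M" if "ends R e = Upair v w" for e w
    using edge_within_cmp_iff[of e ?F v w S] FE S(1) vS no that by blast
  have Sv: "S = {v}" using cmp_eq_singleton[OF fo, of v] nedge v(2) by blast
  have v0: "v \<noteq> Zero_bar" using S(2) vS by (auto simp: exc_def)
  have "w = v" if e: "e \<in> E" "ends R e = Upair v w" for e w
  proof (rule ccontr)
    assume "w \<noteq> v"
    then have nc: "(v, w) \<notin> conn ?F" using Sv v(2) by (auto simp: cmp_def)
    define T where "T = cmp ?F w"
    have T: "T \<in> comps M" using edge_vertsD[OF e] by (auto simp: T_def)
    have z: "Zero_bar \<notin> S" and W: "wedges M S = {}"
      using v0 Sv wedges_subset[of M S] no by auto
    have "good (add_mset e M)"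
    proof (rule good_merge[OF g e nc v(2) T_def])
      show "exc M S + exc M T \<le> 2" using S(2) goodD(3)[OF g T] by simp
      assume "exc M S + exc M T = 2"
      then have T2: "exc M T = 2" using S(2) by simp
      have "exc M X \<le> 1" if "X \<in> comps M" "X \<noteq> T" for X
        using goodD(3)[OF g that(1)] goodD(4)[OF g that(1) T _ T2] that(2) by fastforce
      moreover have "odd_span (insert e ?F) ((S \<union> T) \<inter> {Zero_bar}) (wedges M S \<union> wedges M T)"
        using odd_span_mono[OF goodD(5)[OF g T T2], of "insert e ?F"] z W
        by (auto simp: Int_Un_distrib2)
      ultimately show "(\<forall>X\<in>comps M. X \<noteq> S \<longrightarrow> X \<noteq> T \<longrightarrow> exc M X \<le> 1) \<and>
          odd_span (insert e ?F) ((S \<union> T) \<inter> {Zero_bar}) (wedges M S \<union> wedges M T)" by blast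
    qed
    with m show False by blast
  qed
  then have "v \<in> isolated" using v(1) v0 by (simp add: isolated_def)
  with Sv show ?thesis by blast
qed

text \<open>Compares the total excess with the number of components and combines this with
  \<open>card_forest\<close> and \<open>sum_exc\<close>. The additive form avoids truncated
  subtraction.\<close>

lemma maximal_size:
  assumes g: "good M" and m: "\<nexists>e. good (add_mset e M)"
  shows "size M + 1 + card isolated = card V + of_bool (\<exists>S\<in>comps M. exc M S = 2)"
proof -
  let ?F = "set_mset M"
  have FE: "?F \<subseteq> E" and fo: "forest ?F" using goodD(1,2)[OF g] .
  have fin: "finite (comps M)" using finite_V by simp
  have "{S \<in> comps M. exc M S = 0} = (\<lambda>v. {v}) ` isolated"
  proof (intro equalityI subsetI)
    fix S assume "S \<in> {S \<in> comps M. exc M S = 0}"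
    then have "S \<in> comps M" "exc M S = 0" by simp_all
    from maximal_exc_0[OF g m this] show "S \<in> (\<lambda>v. {v}) ` isolated" by blast
  next
    fix S assume "S \<in> (\<lambda>v. {v}) ` isolated"
    then obtain v where "v \<in> isolated" "S = {v}" by blast
    with isolated_comp[OF g this(1)] show "S \<in> {S \<in> comps M. exc M S = 0}" by simp
  qed
  then have c0: "card {S \<in> comps M. exc M S = 0} = card isolated" by (simp add: card_image)
  have c2: "card {S \<in> comps M. exc M S = 2} = of_bool (\<exists>S\<in>comps M. exc M S = 2)"
  proof (cases "\<exists>S\<in>comps M. exc M S = 2")
    case True
    then obtain S where "S \<in> comps M" "exc M S = 2" by blast
    then have "{S \<in> comps M. exc M S = 2} = {S}" using goodD(4)[OF g, of _ S] by fastforce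
    with True show ?thesis by simp
  next
    case False
    then have "card {S \<in> comps M. exc M S = 2} = 0" by (intro card_eq_0_iff[THEN iffD2]) blast
    with False show ?thesis by (simp only: of_bool_eq)
  qed
  have "(\<Sum>S\<in>X. of_bool (P S)) = card {S \<in> X. P S}" if "finite X"
    for X and P :: "'v bvert set \<Rightarrow> bool"
    using that by (simp add: sum_of_bool_eq Int_def)
  note card = this[OF fin]
  \<comment> \<open>Termwise true for the three possible values 0, 1 and 2; summation counts the
    components of excess 0 and of excess 2.\<close>
  have "(\<Sum>S\<in>comps M. exc M S + of_bool (exc M S = 0)) = (\<Sum>S\<in>comps M. 1 + of_bool (exc M S = 2))"
  proof (rule sum.cong)
    fix S assume "S \<in> comps M"
    then have "exc M S = 0 \<or> exc M S = 1 \<or> exc M S = 2" using goodD(3)[OF g, of S] by linarith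
    then show "exc M S + of_bool (exc M S = 0) = 1 + of_bool (exc M S = 2)" by auto
  qed simp
  then have "(\<Sum>S\<in>comps M. exc M S) + card isolated =
      card (comps M) + of_bool (\<exists>S\<in>comps M. exc M S = 2)"
    unfolding sum.distrib card c0 c2 by simp
  moreover have "card ?F + card (comps M) = card V" by (rule card_forest[OF fo FE])
  ultimately show ?thesis using sum_exc[OF FE] by linarith
qed

lemma maximal_exc_2_iff:
  assumes g: "good M" and m: "\<nexists>e. good (add_mset e M)"
  shows "(\<exists>S\<in>comps M. exc M S = 2) \<longleftrightarrow> (\<exists>f\<in>E. cross f)"
proof
  assume "\<exists>S\<in>comps M. exc M S = 2"
  then obtain S where "S \<in> comps M" "exc M S = 2" by blast
  from odd_span_cross[OF goodD(5)[OF g this]] show "\<exists>f\<in>E. cross f" using goodD(1)[OF g] by blast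
next
  let ?F = "set_mset M"
  have FE: "?F \<subseteq> E" and fo: "forest ?F" using goodD(1,2)[OF g] .
  assume "\<exists>f\<in>E. cross f"
  then obtain f x y where f: "f \<in> E" "ends R f = Upair x y" "x \<in> A" "y \<notin> A" by (auto simp: cross_def)
  show "\<exists>S\<in>comps M. exc M S = 2"
  proof (rule ccontr)
    assume n2: "\<not> (\<exists>S\<in>comps M. exc M S = 2)"
    have le: "\<forall>S\<in>comps M. exc M S \<le> 1"
    proof
      fix S assume S: "S \<in> comps M"
      then have "exc M S \<noteq> 2" using n2 by blast
      then show "exc M S \<le> 1" using goodD(3)[OF g S] by linarith
    qed
    \<comment> \<open>An end of a non-loop edge is not isolated, so by maximality its component does
      not have excess 0. This supplies the excess 1 that both extension lemmas ask for.\<close>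
    have one: "exc M (cmp ?F u) = 1" if "e \<in> E" "ends R e = Upair u w" "u \<noteq> w" for e u w
    proof -
      have u: "cmp ?F u \<in> comps M" using edge_vertsD[OF that(1,2)] by blast
      have "exc M (cmp ?F u) \<noteq> 0"
      proof
        assume "exc M (cmp ?F u) = 0"
        from maximal_exc_0[OF g m u this] obtain v where v: "v \<in> isolated" "cmp ?F u = {v}" by blast
        then have "u = v" using cmp_refl[of u ?F] by blast
        then have "u \<in> isolated" using v(1) by simp
        then have "\<forall>e\<in>E. \<forall>w. ends R e = Upair u w \<longrightarrow> w = u" unfolding isolated_def by blast
        then show False using that by blast
      qed
      moreover have "exc M (cmp ?F u) \<le> 1" using bspec[OF le u] .
      ultimately show ?thesis by linarith
    qed
    show False
    proof (cases "\<exists>e\<in>#M. cross e")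
      case True
      then obtain e where e0: "e \<in># M" "cross e" by blast
      then obtain p q where e: "e \<in># M" "cross e" "ends R e = Upair p q" "p \<in> A" "q \<notin> A"
        unfolding cross_def by blast
      have eE: "e \<in> E" using e(1) FE by blast
      have p: "cmp ?F p \<in> comps M" using edge_vertsD[OF eE e(3)] by blast
      have "e \<in> edges_within (cmp ?F p)" using edge_within_cmp_iff[OF e(1) FE e(3) p] by simp
      moreover have "p \<noteq> q" using e by blast
      ultimately show False using good_extend_within[OF g le p one[OF eE e(3)] _ e(2)] m by simp
    next
      case False
      have xy: "x \<noteq> y" using f by blast
      have "ends R f = Upair y x" using f(2) by (simp add: Upair_inject)
      then have "exc M (cmp ?F y) = 1" using one[OF f(1), of y x] xy by simp
      from good_extend_between[OF g le f one[OF f(1,2) xy] this]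
      have "good (add_mset f M)" using False by blast
      with m show False by blast
    qed
  qed
qed

text \<open>The combined size formula mentions only data of \<open>R\<close> and \<open>A\<close>,
  and a facet admits in particular no extension by a single edge.\<close>

lemma pure_good: "pure (Collect good)"
proof -
  have size: "size M + 1 + card isolated = card V + of_bool (\<exists>f\<in>E. cross f)"
    if M: "M \<in> facets (Collect good)" for M
  proof -
    have g: "good M" and eq: "\<And>N. good N \<Longrightarrow> M \<subseteq># N \<Longrightarrow> N = M"
      using M by (simp_all add: facets_def)
    have m: "\<nexists>e. good (add_mset e M)"
    proof
      assume "\<exists>e. good (add_mset e M)"
      then obtain e where "good (add_mset e M)" by blast
      from eq[OF this] show False by simp
    qed
    show ?thesis using maximal_size[OF g m] unfolding maximal_exc_2_iff[OF g m] .
  qed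
  show ?thesis
    unfolding pure_def
  proof (intro ballI)
    fix M N assume "M \<in> facets (Collect good)" "N \<in> facets (Collect good)"
    from this[THEN size] show "size M = size N" by linarith
  qed
qed

lemma multicomplex_good: "multicomplex E (Collect good)"
  unfolding multicomplex_def
proof (intro conjI ballI allI impI)
  show "finite E" by (rule finite_E)
next
  fix M assume "M \<in> Collect good"
  then show "set_mset M \<subseteq> E" using goodD(1) by simp
next
  fix M N assume "M \<in> Collect good" "N \<subseteq># M"
  then show "N \<in> Collect good" using good_subset_mset by simp
qed

end

section \<open>Biconed graphs\<close>

lemma finite_ugraph_reduced:
  assumes "biconing_data G A B"
  shows "finite_ugraph (reduced G A B)"
proof -
  have G: "finite (verts G)" "finite (edges G)" "\<And>e v. v \<in> set_uprod (ends G e) \<Longrightarrow> e \<in> edges G \<Longrightarrow> v \<in> verts G"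
    and AB: "A \<subseteq> verts G" "B \<subseteq> verts G"
    using assms by (auto simp: biconing_data_def finite_ugraph_def)
  have fin: "finite A" "finite B" using G(1) AB by (auto intro: finite_subset)
  have "set_uprod (ends (reduced G A B) e) \<subseteq> verts (reduced G A B)"
    if "e \<in> edges (reduced G A B)" for e
    using that AB
    by (auto simp: reduced_def biconing_def base_tree_def uprod.set_map) (use G(3) in blast)
  moreover have "finite (verts (reduced G A B))" "finite (edges (reduced G A B))"
    using G fin by (auto simp: reduced_def biconing_def)
  ultimately show ?thesis by (simp add: finite_ugraph_def)
qed

lemma sided_graph_reduced:
  assumes "biconing_data G A B"
  shows "sided_graph (reduced G A B)"
  using finite_ugraph_reduced[OF assms]
  by unfold_locales (auto simp: reduced_def biconing_def)

text \<open>As \<open>Zero\<close> is deleted and \<open>A\<close> and \<open>B\<close> cover the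
  vertices of \<open>G\<close>, a vertex outside the image of \<open>A\<close> is
  \<open>Zero_bar\<close> or comes from \<open>B - A\<close>.\<close>

lemma crossing_reduced_iff:
  assumes "biconing_data G A B" "e \<in> edges (reduced G A B)"
  shows "crossing G A B e \<longleftrightarrow> sided_graph.cross (reduced G A B) (Orig ` A) e"
proof -
  interpret sided_graph "reduced G A B" "Orig ` A" by (rule sided_graph_reduced[OF assms(1)])
  have "V = insert Zero_bar (Orig ` (A \<union> B))"
    using assms(1) by (auto simp: reduced_def biconing_def biconing_data_def)
  then have "y \<in> insert Zero_bar (Orig ` (B - A)) \<longleftrightarrow> y \<notin> Orig ` A" if "y \<in> V" for y
    using that by auto
  then have "(\<exists>y\<in>insert Zero_bar (Orig ` (B - A)). ends (reduced G A B) e = Upair x y) \<longleftrightarrow>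
      (\<exists>y. ends (reduced G A B) e = Upair x y \<and> y \<notin> Orig ` A)" for x
    using edge_vertsD[OF assms(2), of x] by metis
  then show ?thesis unfolding crossing_def cross_def by metis
qed

section \<open>Translation between weighted edge sets and multisets\<close>

lemma count_weighted_mset:
  assumes "finite F"
  shows "count (weighted_mset F \<omega>) e = (if e \<in> F then \<omega> e else 0)"
proof -
  have "count (weighted_mset F \<omega>) e = (\<Sum>x\<in>F. if x = e then \<omega> x else 0)"
    unfolding weighted_mset_def count_sum by (intro sum.cong) auto
  with assms show ?thesis by simp
qed

lemma two_weighted_forest_iff_good:
  assumes "biconing_data G A B" and F: "F \<subseteq> edges (reduced G A B)" "\<omega> \<in> F \<rightarrow> {1..}"
  shows "two_weighted_forest G A B F \<omega> \<longleftrightarrow>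
    sided_graph.good (reduced G A B) (Orig ` A) (weighted_mset F \<omega>)"
proof -
  interpret sided_graph "reduced G A B" "Orig ` A" by (rule sided_graph_reduced[OF assms(1)])
  define M where "M = weighted_mset F \<omega>"
  have finF: "finite F" using F(1) finite_E finite_subset by blast
  have cnt: "count M e = (if e \<in> F then \<omega> e else 0)" for e
    unfolding M_def by (rule count_weighted_mset[OF finF])
  \<comment> \<open>Here the bound \<open>1\<close> on the weights enters: no edge of
    \<open>F\<close> is lost in the multiset.\<close>
  have "e \<in># M \<longleftrightarrow> e \<in> F" for e
  proof -
    have "e \<in># M \<longleftrightarrow> 0 < count M e" by simp
    also have "\<dots> \<longleftrightarrow> e \<in> F" using funcset_mem[OF F(2), of e] unfolding cnt by auto
    finally show ?thesis .
  qed
  then have set: "set_mset M = F" by blast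
  \<comment> \<open>Edges of \<open>E\<close> outside \<open>F\<close> are seen by
    \<open>edges_within\<close> only; having count 0, they affect neither \<open>exc\<close> nor
    \<open>wedges\<close>.\<close>
  have within: "edges_in (sub F) S = edges_within S \<inter> F" for S
    using F(1) by (auto simp: edges_in_def edges_within_def)
  have exc: "excess_weight (sub F) \<omega> S = exc M S" for S
    unfolding excess_weight_def exc_def within
    by (intro arg_cong2[where f = "(+)"] refl sum.mono_neutral_cong_left) (auto simp: cnt)
  have wedges: "weighted_edges_in (sub F) \<omega> S = wedges M S" for S
    unfolding weighted_edges_in_def wedges_def within by (auto simp: cnt)
  have span: "(\<exists>vs es. shortest_path_containing (sub F) U W vs es \<and>
      odd (card {e \<in> set es. crossing G A B e})) \<longleftrightarrow> odd_span F U W" if "forest F" for U W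
  proof -
    have "{e \<in> set es. crossing G A B e} = {e \<in> set es. cross e}"
      if "shortest_path_containing (sub F) U W vs es" for vs es
    proof -
      have "set es \<subseteq> E" using that F(1) by (auto simp: shortest_path_containing_def is_path_spanning)
      then show ?thesis using crossing_reduced_iff[OF assms(1)] by blast
    qed
    then show ?thesis unfolding odd_span_iff[OF that] by (auto cong: conj_cong)
  qed
  have card: "card {S \<in> comps M. exc M S = 2} \<le> 1 \<longleftrightarrow>
      (\<forall>S\<in>comps M. \<forall>T\<in>comps M. exc M S = 2 \<longrightarrow> exc M T = 2 \<longrightarrow> S = T)"
  proof -
    have "finite {S \<in> comps M. exc M S = 2}" using finite_V by simp
    from card_le_Suc0_iff_eq[OF this] show ?thesis unfolding One_nat_def by blast
  qed
  have le: "(\<forall>S\<in>X. exc M S \<noteq> 2 \<longrightarrow> exc M S \<in> {0, 1}) \<longleftrightarrow> (\<forall>S\<in>X. exc M S \<le> 2)" for X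
  proof -
    have "(n \<noteq> 2 \<longrightarrow> n \<in> {0, 1}) \<longleftrightarrow> n \<le> 2" for n :: nat by auto
    then show ?thesis by blast
  qed
  have "two_weighted_forest G A B F \<omega> \<longleftrightarrow> good M"
    unfolding two_weighted_forest_def Let_def good_def components_sub[OF F(1)] forest_iff_acyclic[OF F(1)]
      exc wedges set le card[unfolded set]
    \<comment> \<open>The congruence rule lets \<open>span\<close>, which is valid for forests, use
      the preceding conjunct on acyclicity.\<close>
    using F span by (auto cong: conj_cong)
  then show ?thesis by (simp add: M_def)
qed

lemma two_weighted_forests_eq:
  assumes "biconing_data G A B"
  shows "two_weighted_forests G A B = Collect (sided_graph.good (reduced G A B) (Orig ` A))"
proof -
  interpret sided_graph "reduced G A B" "Orig ` A" by (rule sided_graph_reduced[OF assms])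
  show ?thesis
  proof (intro equalityI subsetI)
    fix M assume "M \<in> two_weighted_forests G A B"
    then obtain F \<omega> where M: "M = weighted_mset F \<omega>" and t: "two_weighted_forest G A B F \<omega>"
      by (auto simp: two_weighted_forests_def)
    from t have "F \<subseteq> E" "\<omega> \<in> F \<rightarrow> {1..}" by (auto simp: two_weighted_forest_def Let_def)
    from two_weighted_forest_iff_good[OF assms this] t M show "M \<in> Collect good" by simp
  next
    fix M assume "M \<in> Collect good"
    then have g: "good M" by simp
    \<comment> \<open>Every multiset is represented by its support, weighted with the
      multiplicities.\<close>
    have eq: "weighted_mset (set_mset M) (count M) = M"
      by (rule multiset_eqI) (simp add: count_weighted_mset not_in_iff)
    have "count M \<in> set_mset M \<rightarrow> {1..}" by (auto simp: Suc_le_eq)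
    from two_weighted_forest_iff_good[OF assms goodD(1)[OF g] this] g eq
    have "two_weighted_forest G A B (set_mset M) (count M)" by simp
    with eq show "M \<in> two_weighted_forests G A B" unfolding two_weighted_forests_def by (metis (mono_tags, lifting) mem_Collect_eq)
  qed
qed

theorem theorem1p3:
  fixes G :: "('v, 'e) ugraph" and A B :: "'v set"
  assumes "biconing_data G A B"
  shows "multicomplex (edges (reduced G A B)) (two_weighted_forests G A B) \<and>
         pure (two_weighted_forests G A B)"
proof -
  interpret sided_graph "reduced G A B" "Orig ` A" by (rule sided_graph_reduced[OF assms])
  show ?thesis
    unfolding two_weighted_forests_eq[OF assms] using multicomplex_good pure_good by blast
qed

end
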